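(* Let $M\ge 2$, let $\mathcal{H}_M$ have orthonormal basis $\{\lvert k\rangle\}_{k=0}^{M-1}$, and let $\mathbb{Z}_M=\{0,\dots,M-1\}$ act by $T(g)\lvert k\rangle=e^{2\pi i kg/M}\lvert k\rangle$. Let $\lvert\psi\rangle=\sum_{k=0}^{M-1}\sqrt{p_k}\lvert k\rangle$ with $p_k\ge0$, $\sum_kp_k=1$. Then, for $G=\mathbb{Z}_M$, \[ R_G(\psi)=A_G^{(reg)}(\psi)=-2\log r_{\max},\qquad r_{\max}=\max_{n\in\{1,\dots,M-1\}}\Big|\sum_{m=0}^{M-1}e^{2\pi i nm/M}p_m\Big|. \]
   Context: All logarithms are base 2; $S$ denotes the von Neumann entropy. On $N$ copies, $\mathbb{Z}_M$ acts by $T(g)^{\otimes N}$. The twirling map is $\mathcal{G}[\rho]=\frac1M\sum_{g=0}^{M-1}T(g)^{\otimes N}\rho\,(T(g)^{\otimes N})^\dagger$ and the $G$-asymmetry is $A_G(\rho)=S(\mathcal{G}[\rho])-S(\rho)$. Accessible information: let $X$ be uniformly distributed on $\mathbb{Z}_M$; given $X=x$ Bob receives $(T(x)\lvert\psi\rangle)^{\otimes N}$ and performs a POVM with outcome random variable $Y$; $I^{(N)}(X:Y)$ is the maximum over all POVMs of the mutual information between $X$ and $Y$. Linearization function for $\mathbb{Z}_M$: $\mathcal{L}(x)=-\log(\log M-x)$. Regularized linearized $G$-asymmetry: $A_G^{(reg)}(\psi)=\lim_{N\to\infty}\frac{1}{N}\mathcal{L}\big(A_G(\lvert\psi\rangle\langle\psi\rvert^{\otimes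 N})\big)$. Alignment rate: $R_G(\psi)=\lim_{N\to\infty}\frac{1}{N}\mathcal{L}\big(I^{(N)}(X:Y)\big)$. *)

theory Defs
  imports "Jordan_Normal_Form.Schur_Decomposition" "HOL-Library.Extended_Real"
begin

definition kron :: "complex mat \<Rightarrow> complex mat \<Rightarrow> complex mat" where
  "kron A B = mat (dim_row A * dim_row B) (dim_col A * dim_col B)
     (\<lambda>(i, j). A $$ (i div dim_row B, j div dim_col B) * B $$ (i mod dim_row B, j mod dim_col B))"

fun kpow :: "complex mat \<Rightarrow> nat \<Rightarrow> complex mat" where
  "kpow A 0 = 1\<^sub>m 1"
| "kpow A (Suc n) = kron (kpow A n) A"

definition msum :: "nat \<Rightarrow> nat \<Rightarrow> ('i \<Rightarrow> complex mat) \<Rightarrow> 'i set \<Rightarrow> complex mat" where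
  "msum r c f I = mat r c (\<lambda>ij. \<Sum>g\<in>I. f g $$ ij)"

definition mtrace :: "complex mat \<Rightarrow> complex" where
  "mtrace A = (\<Sum>i<dim_row A. A $$ (i, i))"

definition psd :: "nat \<Rightarrow> complex mat \<Rightarrow> bool" where
  "psd d A \<longleftrightarrow> A \<in> carrier_mat d d \<and>
     (\<forall>v \<in> carrier_vec d. Im (conjugate v \<bullet> (A *\<^sub>v v)) = 0 \<and> Re (conjugate v \<bullet> (A *\<^sub>v v)) \<ge> 0)"

definition povm :: "nat \<Rightarrow> nat \<Rightarrow> (nat \<Rightarrow> complex mat) \<Rightarrow> bool" where
  "povm d n E \<longleftrightarrow> (\<forall>y<n. psd d (E y)) \<and> msum d d E {..<n} = 1\<^sub>m d"

text \<open>Eigenvalues with multiplicity: a list of roots of the characteristic polynomial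
  (unique up to permutation).\<close>
definition eigvals :: "complex mat \<Rightarrow> complex list" where
  "eigvals A = (SOME es. char_poly A = (\<Prod>a\<leftarrow>es. [:- a, 1:]))"

definition eta :: "real \<Rightarrow> real" where
  "eta x = (if x \<le> 0 then 0 else x * log 2 x)"

definition vN_entropy :: "complex mat \<Rightarrow> real" where
  "vN_entropy \<rho> = - (\<Sum>a\<leftarrow>eigvals \<rho>. eta (Re a))"

text \<open>Projector |v><v| for a column vector v (a d x 1 matrix).\<close>
definition proj :: "complex mat \<Rightarrow> complex mat" where
  "proj v = v * mat_adjoint v"

definition Tgen :: "nat \<Rightarrow> nat \<Rightarrow> complex mat" where
  "Tgen M g = mat M M (\<lambda>(i, j). if i = j then exp (2 * pi * \<i> * of_nat (i * g) / of_nat M) else 0)"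

definition ket :: "nat \<Rightarrow> (nat \<Rightarrow> real) \<Rightarrow> complex mat" where
  "ket M p = mat M 1 (\<lambda>(i, j). complex_of_real (sqrt (p i)))"

definition twirl :: "nat \<Rightarrow> nat \<Rightarrow> complex mat \<Rightarrow> complex mat" where
  "twirl M N \<rho> = (1 / of_nat M) \<cdot>\<^sub>m
     msum (M ^ N) (M ^ N) (\<lambda>g. kpow (Tgen M g) N * \<rho> * mat_adjoint (kpow (Tgen M g) N)) {..<M}"

definition asym :: "nat \<Rightarrow> (nat \<Rightarrow> real) \<Rightarrow> nat \<Rightarrow> real" where
  "asym M p N = (let \<rho> = kpow (proj (ket M p)) N in vN_entropy (twirl M N \<rho>) - vN_entropy \<rho>)"

definition mutual_info :: "nat \<Rightarrow> nat \<Rightarrow> (nat \<Rightarrow> nat \<Rightarrow> real) \<Rightarrow> real" where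
  "mutual_info nx ny P = (\<Sum>x<nx. \<Sum>y<ny.
     if P x y = 0 then 0
     else P x y * log 2 (P x y / ((\<Sum>y'<ny. P x y') * (\<Sum>x'<nx. P x' y))))"

text \<open>Accessible information I^{(N)}(X:Y): X uniform on Z_M, Bob receives
  (T(x)|psi>)^{\<otimes>N} and measures a POVM; supremum (= maximum) over all finite-outcome POVMs.\<close>
definition acc_info :: "nat \<Rightarrow> (nat \<Rightarrow> real) \<Rightarrow> nat \<Rightarrow> real" where
  "acc_info M p N = Sup {mutual_info M n
        (\<lambda>x y. (1 / real M) * Re (mtrace (E y * proj (kpow (Tgen M x * ket M p) N))))
     | n E. povm (M ^ N) n E}"

definition lin :: "nat \<Rightarrow> real \<Rightarrow> ereal" where
  "lin M x = (if x < log 2 (real M) then ereal (- log 2 (log 2 (real M) - x)) else \<infinity>)"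

definition neg2log :: "real \<Rightarrow> ereal" where
  "neg2log r = (if r = 0 then \<infinity> else ereal (- 2 * log 2 r))"

end

theory Submission
  imports Defs
begin

text \<open>
  The vectors \<open>\<psi>\<^sub>g = (T(g)\<psi>)\<^sup>\<otimes>\<^sup>N\<close> have the circulant Gram matrix
  \<open>\<langle>\<psi>\<^sub>a, \<psi>\<^sub>b\<rangle> = s(b - a)\<close>, where \<open>s(n)\<close> is the \<open>N\<close>-th power of the \<open>n\<close>-th Fourier
  coefficient of \<open>p\<close>. Their discrete Fourier transforms \<open>\<phi>\<^sub>k\<close> are therefore orthogonal, with squared
  norms \<open>P\<^sub>k\<close> that satisfy \<open>\<bar>P\<^sub>k - 1/M\<bar> \<le> R\<close> for all \<open>k\<close> and
  \<open>R/M \<le> \<bar>P\<^sub>k - 1/M\<bar>\<close> for some \<open>k\<close>, where \<open>R\<close> is the \<open>N\<close>-th power of \<open>r_max\<close>.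

  The twirled state is the sum of the \<open>|\<phi>\<^sub>k\<rangle>\<langle>\<phi>\<^sub>k|\<close>, so the asymmetry is the Shannon entropy of \<open>P\<close>,
  and \<open>log M - H(P)\<close> lies between constant multiples of \<open>R\<^sup>2\<close>.

  For the accessible information, \<open>log M - I = H(X|Y)\<close>. It is bounded below, for every POVM,
  by comparing only the two states with overlap \<open>R\<close>: the Cauchy-Schwarz inequality for each effect gives
  \<open>R \<le> M \<Sum>\<^sub>y (P(a,y) P(b,y))\<^sup>1\<^sup>/\<^sup>2\<close>. No Holevo bound is needed.
  The covariant measurement along \<open>\<Sum>\<^sub>k \<omega>\<^sup>k\<^sup>y \<phi>\<^sub>k / \<bar>\<phi>\<^sub>k\<bar>\<close> errs with probability of order \<open>R\<^sup>2\<close>, which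
  bounds \<open>H(X|Y)\<close> above by a multiple of \<open>N R\<^sup>2\<close>. The factor \<open>N\<close> does not affect the rate.
\<close>

section \<open>Kronecker powers and adjoints\<close>

lemma dim_mat_adjoint [simp]:
  "dim_row (mat_adjoint A) = dim_col A" "dim_col (mat_adjoint A) = dim_row A"
  by (auto simp: mat_adjoint_def)

lemma mat_adjoint_carrier [simp]: "A \<in> carrier_mat m n \<Longrightarrow> mat_adjoint A \<in> carrier_mat n m"
  by (metis carrier_mat_triv carrier_matD dim_mat_adjoint)

lemma mat_adjoint_index [simp]:
  "i < dim_col A \<Longrightarrow> j < dim_row A \<Longrightarrow> mat_adjoint A $$ (i, j) = cnj (A $$ (j, i))"
  for A :: "complex mat"
  by (simp add: mat_adjoint_def mat_of_rows_def)

lemma dim_kron [simp]: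
  "dim_row (kron A B) = dim_row A * dim_row B" "dim_col (kron A B) = dim_col A * dim_col B"
  by (auto simp: kron_def)

lemma dim_kpow [simp]: "dim_row (kpow A n) = dim_row A ^ n" "dim_col (kpow A n) = dim_col A ^ n"
  by (induction n) auto

text \<open>Division with remainder identifies \<open>{..<m * n}\<close> with pairs.
  \<open>kron\<close> indexes its entries in this way, so the contraction in a product of Kronecker
  products splits into two.\<close>

lemma sum_lessThan_prod:
  fixes m n :: nat
  shows "(\<Sum>k<m * n. f (k div n) * g (k mod n)) = (\<Sum>i<m. f i) * (\<Sum>j<n. g j :: 'a :: comm_semiring_0)"
proof -
  have "(\<Sum>k<m * n. f (k div n) * g (k mod n)) = (\<Sum>(i, j)\<in>{..<m} \<times> {..<n}. f i * g j)"
  proof (rule sum.reindex_bij_witness[of _ "\<lambda>(i, j). i * n + j" "\<lambda>k. (k div n, k mod n)"])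
    fix b assume "b \<in> {..<m} \<times> {..<n}"
    then obtain i j where b: "b = (i, j)" "i < m" "j < n" by auto
    have "i * n + j < Suc i * n" using b by simp
    also have "\<dots> \<le> m * n" using b by (intro mult_right_mono) auto
    finally show "(case b of (i, j) \<Rightarrow> i * n + j) \<in> {..<m * n}" using b by simp
    show "((case b of (i, j) \<Rightarrow> i * n + j) div n, (case b of (i, j) \<Rightarrow> i * n + j) mod n) = b"
      using b by simp
  next
    fix a assume a: "a \<in> {..<m * n}"
    then have "n > 0" by (cases n) auto
    with a show "(a div n, a mod n) \<in> {..<m} \<times> {..<n}"
      by (simp add: less_mult_imp_div_less)
  qed auto
  then show ?thesis
    by (simp add: sum.cartesian_product[symmetric] sum_product)
qed

lemma mod_less_of_mult: "i < a * b \<Longrightarrow> i mod b < (b :: nat)"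
  by (cases b) auto

lemma kron_mult:
  assumes "dim_col A = dim_row C" "dim_col B = dim_row D"
  shows "kron A B * kron C D = kron (A * C) (B * D)"
proof (rule eq_matI)
  fix i j assume ij: "i < dim_row (kron (A * C) (B * D))" "j < dim_col (kron (A * C) (B * D))"
  let ?n = "dim_col A" and ?n' = "dim_col B"
  have ij': "i div dim_row B < dim_row A" "i mod dim_row B < dim_row B"
    "j div dim_col D < dim_col C" "j mod dim_col D < dim_col D"
    using ij by (auto intro: less_mult_imp_div_less mod_less_of_mult)
  have "(kron A B * kron C D) $$ (i, j) = (\<Sum>k<?n * ?n'.
      (A $$ (i div dim_row B, k div ?n') * C $$ (k div ?n', j div dim_col D)) *
      (B $$ (i mod dim_row B, k mod ?n') * D $$ (k mod ?n', j mod dim_col D)))"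
    using ij assms
    by (auto simp: scalar_prod_def kron_def lessThan_atLeast0 mult_ac intro!: sum.cong)
  also have "\<dots> = (\<Sum>k<?n. A $$ (i div dim_row B, k) * C $$ (k, j div dim_col D)) *
      (\<Sum>k<?n'. B $$ (i mod dim_row B, k) * D $$ (k, j mod dim_col D))"
    by (rule sum_lessThan_prod)
  also have "\<dots> = kron (A * C) (B * D) $$ (i, j)"
    using ij assms ij' by (simp add: kron_def scalar_prod_def lessThan_atLeast0)
  finally show "(kron A B * kron C D) $$ (i, j) = kron (A * C) (B * D) $$ (i, j)" .
qed auto

lemma kpow_mult: "dim_col A = dim_row B \<Longrightarrow> kpow A n * kpow B n = kpow (A * B) n"
  by (induction n) (simp_all add: kron_mult)

lemma mat_adjoint_kron: "mat_adjoint (kron A B) = kron (mat_adjoint A) (mat_adjoint B)"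
  by (rule eq_matI) (auto simp: kron_def less_mult_imp_div_less mod_less_of_mult)

lemma mat_adjoint_kpow: "mat_adjoint (kpow A n) = kpow (mat_adjoint A) n"
proof (induction n)
  case 0
  show ?case by (rule eq_matI) auto
qed (simp add: mat_adjoint_kron)

lemma kpow_proj: "kpow (proj v) n = proj (kpow v n)"
  by (simp add: proj_def mat_adjoint_kpow kpow_mult)

lemma kpow_scalar:
  assumes "A \<in> carrier_mat 1 1" shows "kpow A n $$ (0, 0) = (A $$ (0, 0)) ^ n"
  using assms by (induction n) (auto simp: kron_def)

lemma mat_adjoint_mult:
  assumes "dim_col A = dim_row B"
  shows "mat_adjoint (A * B) = mat_adjoint B * mat_adjoint (A :: complex mat)"
  using assms by (intro eq_matI) (auto simp: scalar_prod_def intro!: sum.cong)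

lemma proj_index:
  assumes "v \<in> carrier_mat d 1" "i < d" "j < d"
  shows "proj v $$ (i, j) = v $$ (i, 0) * cnj (v $$ (j, 0))"
  using assms by (auto simp: proj_def scalar_prod_def)

lemma conj_proj:
  assumes "dim_col U = dim_row v"
  shows "U * proj v * mat_adjoint U = proj (U * v)"
proof -
  let ?a = "dim_row U" and ?b = "dim_row v" and ?c = "dim_col v"
  have U: "U \<in> carrier_mat ?a ?b" using assms by auto
  have v: "v \<in> carrier_mat ?b ?c" by auto
  note U' = mat_adjoint_carrier[OF U] and v' = mat_adjoint_carrier[OF v]
  have "U * (v * mat_adjoint v) = U * v * mat_adjoint v"
    by (rule assoc_mult_mat[OF U v v', symmetric])
  moreover have "U * v * mat_adjoint v * mat_adjoint U = U * v * (mat_adjoint v * mat_adjoint U)"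
    by (rule assoc_mult_mat[OF mult_carrier_mat[OF U v] v' U'])
  ultimately show ?thesis
    unfolding proj_def by (simp add: mat_adjoint_mult[OF assms])
qed

lemma kpow_conj_proj:
  assumes "dim_col U = dim_row v"
  shows "kpow U n * kpow (proj v) n * mat_adjoint (kpow U n) = proj (kpow (U * v) n)"
  using assms by (simp add: kpow_proj conj_proj kpow_mult)

section \<open>Entropy of \<open>A A\<^sup>*\<close>\<close>

text \<open>The block triangular matrices \<open>?X\<close> and \<open>?Y\<close> are similar
  through the unipotent \<open>?P\<close>. Their diagonal blocks, \<open>A * B\<close> and zero
  against zero and \<open>B * A\<close>, produce the two sides.\<close>

lemma char_poly_mult_swap:
  fixes A B :: "complex mat"
  assumes A: "A \<in> carrier_mat m n" and B: "B \<in> carrier_mat n m"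
  shows "char_poly (A * B) * [:0, 1:] ^ n = [:0, 1:] ^ m * char_poly (B * A)"
proof -
  \<comment> \<open>Over the complex numbers every characteristic polynomial splits; the rule for
    block triangular matrices asks for this on both diagonal blocks.\<close>
  have fac: "\<exists>es. char_poly C = (\<Prod>a\<leftarrow>es. [:- a, 1:])" if "C \<in> carrier_mat k k"
    for C :: "complex mat" and k using char_poly_factorized[OF that] by blast
  note AB = mult_carrier_mat[OF A B] and BA = mult_carrier_mat[OF B A]
  have zero: "char_poly (0\<^sub>m k k :: complex mat) = [:0, 1:] ^ k" for k
  proof -
    have "diag_mat (0\<^sub>m k k :: complex mat) = replicate k 0"
      by (rule nth_equalityI) (auto simp: diag_mat_def)
    then show ?thesis by (subst char_poly_upper_triangular[of _ k]) auto
  qed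
  have fac_zero: "\<exists>es. char_poly (0\<^sub>m k k :: complex mat) = (\<Prod>a\<leftarrow>es. [:- a, 1:])" for k
    by (rule fac[OF zero_carrier_mat])
  let ?X = "four_block_mat (A * B) (0\<^sub>m m n) B (0\<^sub>m n n)"
  let ?Y = "four_block_mat (0\<^sub>m m m) (0\<^sub>m m n) B (B * A)"
  let ?P = "four_block_mat (1\<^sub>m m) A (0\<^sub>m n m) (1\<^sub>m n)"
  let ?Q = "four_block_mat (1\<^sub>m m) (- A) (0\<^sub>m n m) (1\<^sub>m n)"
  have one: "four_block_mat (1\<^sub>m m) (0\<^sub>m m n) (0\<^sub>m n m) (1\<^sub>m n) = (1\<^sub>m (m + n) :: complex mat)"
    by (rule eq_matI) auto
  have neg_zero: "- 0\<^sub>m n n = (0\<^sub>m n n :: complex mat)"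
    by (rule eq_matI) auto
  have add_neg: "A + - A = 0\<^sub>m m n" "- A + A = 0\<^sub>m m n"
    using A by auto
  have PQ: "?P * ?Q = 1\<^sub>m (m + n)"
    by (subst mult_four_block_mat[of _ m m _ n _ n _ _ m _ n]) (use A in \<open>auto simp: one neg_zero add_neg\<close>)
  have QP: "?Q * ?P = 1\<^sub>m (m + n)"
    by (subst mult_four_block_mat[of _ m m _ n _ n _ _ m _ n]) (use A in \<open>auto simp: one neg_zero add_neg\<close>)
  have PY: "?P * ?Y = four_block_mat (A * B) (A * (B * A)) B (B * A)"
    by (subst mult_four_block_mat[of _ m m _ n _ n _ _ m _ n]) (use A B AB BA in auto)
  have "four_block_mat (A * B) (A * (B * A)) B (B * A) * ?Q = ?X"
    by (subst mult_four_block_mat[of _ m m _ n _ n _ _ m _ n])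
      (use A B AB BA in \<open>auto simp: assoc_mult_mat[OF A B A]\<close>)
  then have "?X = ?P * ?Y * ?Q" using PY by simp
  then have "similar_mat ?X ?Y"
    by (intro similar_matI[OF _ PQ QP]) (use A B AB BA in auto)
  then have "char_poly ?X = char_poly ?Y" by (rule char_poly_similar)
  moreover have "char_poly ?X = char_poly (A * B) * char_poly (0\<^sub>m n n :: complex mat)"
    by (rule char_poly_0_block'[OF refl fac[OF AB] fac_zero AB B zero_carrier_mat])
  moreover have "char_poly ?Y = char_poly (0\<^sub>m m m :: complex mat) * char_poly (B * A)"
    by (rule char_poly_0_block'[OF refl fac_zero fac[OF BA] zero_carrier_mat B BA])
  ultimately show ?thesis by (simp add: zero)
qed

text \<open>The multiplicity of \<open>a\<close> in the list is its order as a root, which the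
  polynomial determines. Hence sums over \<open>eigvals\<close> do not depend on which root list is
  chosen.\<close>

lemma mset_eqI_linear_factors:
  fixes xs ys :: "complex list"
  assumes "(\<Prod>a\<leftarrow>xs. [:- a, 1:]) = (\<Prod>a\<leftarrow>ys. [:- a, 1:])"
  shows "mset xs = mset ys"
proof -
  have ord: "count (mset zs) a = order a (\<Prod>a\<leftarrow>zs. [:- a, 1:])" for a and zs :: "complex list"
  proof (induction zs)
    case (Cons z zs)
    have "(\<Prod>a\<leftarrow>zs. [:- a, 1:]) \<noteq> 0" by (auto simp: prod_list_zero_iff)
    then have "order a ([:- z, 1:] * (\<Prod>a\<leftarrow>zs. [:- a, 1:])) = order a [:- z, 1:] + order a (\<Prod>a\<leftarrow>zs. [:- a, 1:])"
      by (intro order_mult) (simp del: mult_pCons_left)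
    moreover have "order a [:- z, 1:] = (if z = a then 1 else 0)"
      using order_power_n_n[of a 1] by (auto simp: order_0I)
    ultimately show ?case using Cons by (simp del: mult_pCons_left)
  qed (simp add: order_0I)
  show ?thesis by (rule multiset_eqI) (simp add: ord assms)
qed

text \<open>\<open>mat_adjoint A * A\<close> is the Gram matrix of the columns of \<open>A\<close>
  and shares its nonzero eigenvalues with \<open>A * mat_adjoint A\<close>. For orthogonal columns
  the entropy can be read off from the squared norms.\<close>

lemma vN_entropy_mult_adjoint:
  assumes A: "A \<in> carrier_mat d m"
    and diag: "mat_adjoint A * A = mat m m (\<lambda>(i, j). if i = j then complex_of_real (f i) else 0)"
  shows "vN_entropy (A * mat_adjoint A) = - (\<Sum>k<m. eta (f k))"
proof -
  let ?B = "mat_adjoint A"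
  have AB: "A * ?B \<in> carrier_mat d d" using A by (auto intro!: mult_carrier_mat[of _ _ m])
  obtain es where "char_poly (A * ?B) = (\<Prod>a\<leftarrow>es. [:- a, 1:])"
    using char_poly_factorized[OF AB] by blast
  then have es: "char_poly (A * ?B) = (\<Prod>a\<leftarrow>eigvals (A * ?B). [:- a, 1:])"
    unfolding eigvals_def by (rule someI)
  let ?D = "?B * A" and ?fs = "map (\<lambda>k. complex_of_real (f k)) [0..<m]"
  have "diag_mat ?D = ?fs" unfolding diag by (auto simp: diag_mat_def)
  then have D: "char_poly ?D = (\<Prod>a\<leftarrow>?fs. [:- a, 1:])"
    by (subst char_poly_upper_triangular[of _ m]) (auto simp: diag)
  have rep: "(\<Prod>a\<leftarrow>replicate k (0::complex). [:- a, 1:]) = [:0, 1:] ^ k" for k by simp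
  \<comment> \<open>The powers of the indeterminate become \<open>m\<close> and \<open>d\<close>
    extra zero eigenvalues, invisible to the entropy because \<open>eta 0 = 0\<close>.\<close>
  have "(\<Prod>a\<leftarrow>eigvals (A * ?B) @ replicate m 0. [:- a, 1:]) = (\<Prod>a\<leftarrow>replicate d 0 @ ?fs. [:- a, 1:])"
    using char_poly_mult_swap[OF A mat_adjoint_carrier[OF A]]
    unfolding es D map_append prod_list.append rep .
  from arg_cong[OF mset_eqI_linear_factors[OF this], of "\<lambda>A. sum_mset (image_mset (\<lambda>a. eta (Re a)) A)"]
  have "(\<Sum>a\<leftarrow>eigvals (A * ?B) @ replicate m 0. eta (Re a)) = (\<Sum>a\<leftarrow>replicate d 0 @ ?fs. eta (Re a))"
    unfolding mset_map[symmetric] sum_mset_sum_list .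
  then show ?thesis
    by (simp add: vN_entropy_def sum_list_replicate eta_def[of 0] interv_sum_list_conv_sum_set_nat o_def lessThan_atLeast0)
qed

section \<open>Mutual information with a uniform input\<close>

lemma mutual_info_cong:
  assumes "\<And>x y. x < m \<Longrightarrow> y < n \<Longrightarrow> P x y = Q x y"
  shows "mutual_info m n P = mutual_info m n Q"
  using assms unfolding mutual_info_def by (intro sum.cong) auto

text \<open>As \<open>H(X) = log M\<close>, the deficit is the conditional entropy
  \<open>H(X|Y)\<close>. Natural logarithms make \<open>ln z \<le> z - 1\<close> directly applicable
  to its terms.\<close>

lemma mutual_info_deficit:
  assumes M: "M > 0" and nonneg: "\<And>x y. x < M \<Longrightarrow> y < n \<Longrightarrow> P x y \<ge> 0"
    and unif: "\<And>x. x < M \<Longrightarrow> (\<Sum>y<n. P x y) = 1 / real M"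
  shows "log 2 M - mutual_info M n P = (\<Sum>y<n. \<Sum>x<M.
    if P x y = 0 then 0 else P x y * ln ((\<Sum>x'<M. P x' y) / P x y)) / ln 2"
proof -
  let ?Q = "\<lambda>y. \<Sum>x'<M. P x' y"
  let ?h = "\<lambda>x y. if P x y = 0 then 0 else P x y * ln (?Q y / P x y)"
  have term_eq: "(if P x y = 0 then 0 else P x y * log 2 (P x y / ((\<Sum>y'<n. P x y') * ?Q y)))
      = P x y * log 2 M - ?h x y / ln 2" if x: "x < M" and y: "y < n" for x y
  proof (cases "P x y = 0")
    case False
    with nonneg[OF x y] have P: "P x y > 0" by simp
    also have "P x y \<le> ?Q y" using x y nonneg by (intro member_le_sum) auto
    finally have "?Q y > 0" .
    with P M show ?thesis
      by (simp add: unif[OF x] log_def ln_mult ln_div field_simps)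
  qed simp
  have "mutual_info M n P = (\<Sum>x<M. \<Sum>y<n. P x y * log 2 M - ?h x y / ln 2)"
    unfolding mutual_info_def by (intro sum.cong refl term_eq) auto
  also have "\<dots> = (\<Sum>x<M. \<Sum>y<n. P x y) * log 2 M - (\<Sum>x<M. \<Sum>y<n. ?h x y) / ln 2"
    by (simp add: sum_subtractf sum_distrib_right sum_divide_distrib)
  also have "(\<Sum>x<M. \<Sum>y<n. P x y) = 1" using M by (simp add: unif)
  finally show ?thesis by (simp add: sum.swap[of _ "{..<M}"])
qed

text \<open>This concerns a single outcome, with unnormalized weights \<open>p\<close>. The
  inequality \<open>ln z \<le> z - 1\<close> bounds each term below by
  \<open>p x * (q - p x) / q\<close>; only \<open>a\<close> and \<open>b\<close> are kept, and each
  lies within the complement of the other.\<close>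

lemma conditional_entropy_pair_bound:
  fixes M :: nat
  assumes nonneg: "\<And>x. x < M \<Longrightarrow> p x \<ge> (0::real)" and ab: "a < M" "b < M" "a \<noteq> b"
  shows "2 * (p a * p b / (\<Sum>x<M. p x)) \<le> (\<Sum>x<M. if p x = 0 then 0 else p x * ln ((\<Sum>x<M. p x) / p x))"
proof -
  define q where "q = (\<Sum>x<M. p x)"
  have q: "p x \<le> q" if "x < M" for x
    using that nonneg unfolding q_def by (intro member_le_sum) auto
  have term_bound: "p x * (q - p x) / q \<le> (if p x = 0 then 0 else p x * ln (q / p x))" if x: "x < M" for x
  proof (cases "p x = 0")
    case False
    then have p: "p x > 0" using nonneg[OF x] by simp
    have "q > 0" using p q[OF x] by simp
    then have "ln (p x / q) \<le> p x / q - 1" using p by (intro ln_le_minus_one) auto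
    with p \<open>q > 0\<close> have "1 - p x / q \<le> ln (q / p x)" by (simp add: ln_div)
    then have "p x * (1 - p x / q) \<le> p x * ln (q / p x)" using p by (intro mult_left_mono) auto
    with p \<open>q > 0\<close> show ?thesis by (simp add: field_simps)
  qed simp
  have sum_ab: "p a + p b \<le> q"
  proof -
    have "(\<Sum>x\<in>{a, b}. p x) \<le> q"
      unfolding q_def using ab nonneg by (intro sum_mono2) auto
    then show ?thesis using ab by simp
  qed
  have q0: "q \<ge> 0" using nonneg[OF ab(1)] q[OF ab(1)] by simp
  have "2 * (p a * p b / q) \<le> p a * (q - p a) / q + p b * (q - p b) / q"
  proof -
    have "p a * p b \<le> p a * (q - p a)" "p b * p a \<le> p b * (q - p b)"
      using sum_ab nonneg ab by (auto intro!: mult_left_mono)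
    then have "(2 * (p a * p b)) / q \<le> (p a * (q - p a) + p b * (q - p b)) / q"
      using q0 by (intro divide_right_mono) (auto simp: mult.commute)
    then show ?thesis by (simp add: add_divide_distrib)
  qed
  also have "\<dots> = (\<Sum>x\<in>{a, b}. p x * (q - p x) / q)" using ab by simp
  also have "\<dots> \<le> (\<Sum>x<M. p x * (q - p x) / q)"
    using ab q nonneg q0 by (intro sum_mono2) auto
  also have "\<dots> \<le> (\<Sum>x<M. if p x = 0 then 0 else p x * ln (q / p x))"
    by (intro sum_mono term_bound) simp
  finally show ?thesis unfolding q_def .
qed

text \<open>The pair bound gives the deficit \<open>2 * K / ln 2\<close> at least. Cauchy-Schwarz
  with the weights \<open>Q\<close>, which sum to 1, then yields \<open>S^2 \<le> K\<close>.\<close>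

lemma mutual_info_le_overlap:
  assumes M: "M > 0" and nonneg: "\<And>x y. x < M \<Longrightarrow> y < n \<Longrightarrow> P x y \<ge> 0"
    and unif: "\<And>x. x < M \<Longrightarrow> (\<Sum>y<n. P x y) = 1 / real M"
    and ab: "a < M" "b < M" "a \<noteq> b"
  shows "mutual_info M n P \<le> log 2 M - 2 / ln 2 * (\<Sum>y<n. sqrt (P a y * P b y))\<^sup>2"
proof -
  define Q where "Q y = (\<Sum>x<M. P x y)" for y
  have deficit: "log 2 M - mutual_info M n P = (\<Sum>y<n. \<Sum>x<M.
      if P x y = 0 then 0 else P x y * ln (Q y / P x y)) / ln 2"
    unfolding Q_def by (rule mutual_info_deficit) (use M nonneg unif in auto)
  define S where "S = (\<Sum>y<n. sqrt (P a y * P b y))"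
  define K where "K = (\<Sum>y<n. P a y * P b y / Q y)"
  have Q: "(\<Sum>y<n. Q y) = 1"
    unfolding Q_def using M by (subst sum.swap) (simp add: unif)
  have PQ: "P x y \<le> Q y" if "x < M" "y < n" for x y
    using that nonneg unfolding Q_def by (intro member_le_sum) auto
  have S0: "S \<ge> 0" unfolding S_def using nonneg ab by (intro sum_nonneg) auto
  have K0: "K \<ge> 0" unfolding K_def Q_def using nonneg ab
    by (intro sum_nonneg divide_nonneg_nonneg mult_nonneg_nonneg) auto
  have "S\<^sup>2 \<le> K"
  proof (cases "S = 0")
    case False
    with S0 have S: "S > 0" by simp
    \<comment> \<open>Cauchy-Schwarz in linearized form: the inequality of arithmetic and geometric
      means with \<open>S\<close> as the weight, whose sum over \<open>y\<close> reads
      \<open>2 * S \<le> S + K / S\<close>.\<close>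
    have "2 * sqrt (P a y * P b y) \<le> S * Q y + P a y * P b y / Q y / S" if y: "y < n" for y
    proof (cases "Q y = 0")
      case True
      then have "P a y = 0" using PQ[OF ab(1) y] nonneg[OF ab(1) y] by simp
      then show ?thesis using True by simp
    next
      case False
      then have Qy: "Q y > 0" using PQ[OF ab(1) y] nonneg[OF ab(1) y] by simp
      define t where "t = sqrt (P a y * P b y)"
      have t: "P a y * P b y = t\<^sup>2" unfolding t_def using nonneg ab y by simp
      have "S * Q y + t\<^sup>2 / Q y / S - 2 * t = (S * Q y - t)\<^sup>2 / (S * Q y)"
        using S Qy by (simp add: field_simps power2_eq_square)
      also have "\<dots> \<ge> 0" using S Qy by simp
      finally have "2 * t \<le> S * Q y + t\<^sup>2 / Q y / S" by simp
      then show ?thesis unfolding t_def[symmetric] by (simp only: t)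
    qed
    then have "(\<Sum>y<n. 2 * sqrt (P a y * P b y)) \<le> (\<Sum>y<n. S * Q y + P a y * P b y / Q y / S)"
      by (intro sum_mono) simp
    then have "2 * S \<le> S + K / S"
      by (simp add: S_def[symmetric] K_def sum.distrib sum_distrib_left[symmetric] sum_divide_distrib Q)
    then have "S \<le> K / S" by simp
    then show ?thesis using S by (simp add: field_simps power2_eq_square)
  qed (use K0 in simp)
  moreover have "2 * K \<le> (\<Sum>y<n. \<Sum>x<M. if P x y = 0 then 0 else P x y * ln (Q y / P x y))"
    unfolding K_def Q_def sum_distrib_left
    by (intro sum_mono conditional_entropy_pair_bound nonneg ab) auto
  ultimately have "2 * S\<^sup>2 / ln 2 \<le> log 2 M - mutual_info M n P"
    unfolding deficit by (intro divide_right_mono) auto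
  then show ?thesis unfolding S_def by simp
qed

text \<open>Outcome \<open>y\<close> is read as the guess \<open>x = y\<close>, and an outcome
  beyond \<open>M\<close> is an error for every input. A correct guess costs at most the total error
  weight at that outcome; a wrong one costs about \<open>- \<epsilon> * ln \<epsilon>\<close>, where
  \<open>B\<close> controls the logarithm.\<close>

lemma mutual_info_ge_of_small_error:
  assumes M: "M > 0" and nonneg: "\<And>x y. x < M \<Longrightarrow> y < n \<Longrightarrow> P x y \<ge> 0"
    and unif: "\<And>x. x < M \<Longrightarrow> (\<Sum>y<n. P x y) = 1 / real M"
    and err: "\<And>x y. x < M \<Longrightarrow> y < n \<Longrightarrow> x \<noteq> y \<Longrightarrow> P x y \<le> \<epsilon>"
    and eps: "\<epsilon> \<ge> 0" "\<epsilon> > 0 \<Longrightarrow> - ln \<epsilon> \<le> B" and B: "B \<ge> 0"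
  shows "mutual_info M n P \<ge> log 2 M - real n * real M * \<epsilon> * (real M + 1 + B) / ln 2"
proof -
  define Q where "Q y = (\<Sum>x<M. P x y)" for y
  have deficit: "log 2 M - mutual_info M n P = (\<Sum>y<n. \<Sum>x<M.
      if P x y = 0 then 0 else P x y * ln (Q y / P x y)) / ln 2"
    unfolding Q_def by (rule mutual_info_deficit) (use M nonneg unif in auto)
  have "(if P x y = 0 then 0 else P x y * ln (Q y / P x y)) \<le> \<epsilon> * (real M + 1 + B)"
    if x: "x < M" and y: "y < n" for x y
  proof (cases "P x y = 0")
    case True
    then show ?thesis using eps B by simp
  next
    case False
    then have P: "P x y > 0" using nonneg[OF x y] by simp
    also have PQ: "P x y \<le> Q y" using x y nonneg unfolding Q_def by (intro member_le_sum) auto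
    finally have Qy: "Q y > 0" .
    show ?thesis
    proof (cases "x = y")
      case True
      have "P x y * ln (Q y / P x y) \<le> P x y * (Q y / P x y - 1)"
        using P Qy by (intro mult_left_mono ln_le_minus_one) auto
      also have "\<dots> = Q y - P x y" using P by (simp add: field_simps)
      also have "\<dots> = (\<Sum>x'\<in>{..<M} - {x}. P x' y)"
        unfolding Q_def using x by (simp add: sum_diff1)
      also have "\<dots> \<le> of_nat (card ({..<M} - {x})) * \<epsilon>"
        using err y True by (intro sum_bounded_above) auto
      also have "\<dots> \<le> real M * \<epsilon>" using eps x by (intro mult_right_mono) auto
      also have "\<dots> \<le> \<epsilon> * (real M + 1 + B)" using eps B by (simp add: algebra_simps)
      finally show ?thesis using False by simp
    next
      case neq: False
      have Pe: "P x y \<le> \<epsilon>" using err[OF x y neq] .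
      with P have e: "\<epsilon> > 0" by simp
      have "(\<Sum>x<M. P x y) \<le> (\<Sum>x<M. \<Sum>y<n. P x y)"
        using nonneg y by (intro sum_mono member_le_sum) auto
      also have "\<dots> = 1" using M by (simp add: unif)
      finally have "Q y \<le> 1" unfolding Q_def .
      then have "ln (Q y / P x y) \<le> - ln (P x y)" using P Qy by (simp add: ln_div)
      \<comment> \<open>Since \<open>- t * ln t\<close> need not be monotone up to
        \<open>\<epsilon>\<close>, the logarithm is split at \<open>\<epsilon>\<close>: the first
        part is at most \<open>\<epsilon> / P x y - 1\<close>, the second at most
        \<open>B\<close>.\<close>
      also have "\<dots> = ln (\<epsilon> / P x y) - ln \<epsilon>" using P e by (simp add: ln_div)
      also have "\<dots> \<le> (\<epsilon> / P x y - 1) + B"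
        using P e eps by (intro add_mono[of _ _ "- ln \<epsilon>", simplified] ln_le_minus_one) auto
      finally have "P x y * ln (Q y / P x y) \<le> P x y * (\<epsilon> / P x y - 1 + B)"
        using P by (intro mult_left_mono) auto
      also have "\<dots> = \<epsilon> - P x y + P x y * B" using P by (simp add: field_simps)
      also have "\<dots> \<le> \<epsilon> + \<epsilon> * B" using P Pe B by (intro add_mono mult_right_mono) auto
      also have "\<dots> \<le> \<epsilon> * (real M + 1 + B)" using e by (simp add: algebra_simps)
      finally show ?thesis using False by simp
    qed
  qed
  then have "(\<Sum>y<n. \<Sum>x<M. if P x y = 0 then 0 else P x y * ln (Q y / P x y))
      \<le> (\<Sum>y<n. \<Sum>x<M. \<epsilon> * (real M + 1 + B))"
    by (intro sum_mono) auto
  then have "log 2 M - mutual_info M n P \<le> (\<Sum>y<n. \<Sum>x<M. \<epsilon> * (real M + 1 + B)) / ln 2"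
    unfolding deficit by (intro divide_right_mono) auto
  then show ?thesis by (simp add: mult.assoc)
qed

section \<open>Characters of \<open>\<int>/M\<close>\<close>

text \<open>The argument is an integer, so that conjugation and differences of indices become
  genuine negation and subtraction.\<close>

definition root_char :: "nat \<Rightarrow> int \<Rightarrow> complex" where
  "root_char M z = cis (2 * pi * real_of_int z / real M)"

lemma root_char_add: "root_char M (a + b) = root_char M a * root_char M b"
  by (simp add: root_char_def cis_mult add_divide_distrib ring_distribs)

lemma root_char_0 [simp]: "root_char M 0 = 1"
  by (simp add: root_char_def)

lemma cnj_root_char [simp]: "cnj (root_char M z) = root_char M (- z)"
  by (simp add: root_char_def cis_cnj)

lemma norm_root_char [simp]: "cmod (root_char M z) = 1"
  by (simp add: root_char_def)

lemma root_char_eq_1_iff: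
  assumes "M > 0" shows "root_char M z = 1 \<longleftrightarrow> int M dvd z"
proof
  assume "root_char M z = 1"
  then have "cos (2 * pi * real_of_int z / real M) = 1"
    by (simp add: root_char_def complex_eq_iff)
  then obtain n :: int where "2 * pi * real_of_int z / real M = real_of_int n * 2 * pi"
    using cos_one_2pi_int by auto
  then have "real_of_int z = real_of_int (n * int M)"
    using assms by (simp add: field_simps)
  then have "z = n * int M" by (simp only: of_int_eq_iff)
  then show "int M dvd z" by simp
next
  assume "int M dvd z"
  then obtain n where "z = int M * n" by blast
  then have "2 * pi * real_of_int z / real M = 2 * pi * real_of_int n"
    using assms by simp
  then show "root_char M z = 1" by (simp only: root_char_def cis_multiple_2pi Ints_of_int)
qed

lemma root_char_power: "root_char M z ^ x = root_char M (z * int x)"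
  by (induction x) (simp_all add: ring_distribs root_char_add)

text \<open>In the nontrivial case this is a geometric sum whose ratio is an \<open>M\<close>-th
  root of unity other than 1.\<close>

lemma sum_root_char:
  assumes "M > 0"
  shows "(\<Sum>x<M. root_char M (z * int x)) = (if int M dvd z then of_nat M else 0)"
proof (cases "int M dvd z")
  case True
  then have "root_char M (z * int x) = 1" for x
    using root_char_eq_1_iff[OF assms] by simp
  then show ?thesis using True by simp
next
  case False
  then have "root_char M z \<noteq> 1" using root_char_eq_1_iff[OF assms] by simp
  moreover have "root_char M z ^ M = 1"
    unfolding root_char_power using root_char_eq_1_iff[OF assms] by simp
  ultimately show ?thesis
    using False by (simp add: root_char_power[symmetric] sum_gp_strict)
qed

lemma int_dvd_diff_iff:
  assumes "k < M" "l < M" shows "int M dvd int k - int l \<longleftrightarrow> k = l"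
  using assms by (metis mod_eq_dvd_iff mod_less of_nat_eq_iff of_nat_mod)

lemma sum_root_char_diff:
  assumes "k < M" "l < M"
  shows "(\<Sum>x<M. root_char M ((int k - int l) * int x)) = (if k = l then of_nat M else 0)"
  using assms by (subst sum_root_char) (auto simp: int_dvd_diff_iff)

lemma sum_swap3: "(\<Sum>x\<in>A. \<Sum>k\<in>B. \<Sum>l\<in>C. F x k l) = (\<Sum>k\<in>B. \<Sum>l\<in>C. \<Sum>x\<in>A. F x k l)"
  by (rule trans[OF sum.swap sum.cong[OF refl sum.swap]])

text \<open>Orthogonality of characters removes the cross terms. It serves twice, entrywise: for the
  average over the orbit and for the completeness of the Fourier measurement.\<close>

lemma parseval_root_char:
  "(\<Sum>x<M. (\<Sum>k<M. root_char M (int k * int x) * a k) * cnj (\<Sum>k<M. root_char M (int k * int x) * b k))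
    = of_nat M * (\<Sum>k<M. a k * cnj (b k))"
proof -
  have diff: "root_char M ((int k - int l) * int x) = root_char M (int k * int x) * root_char M (- (int l * int x))"
    for k l x by (simp add: root_char_add[symmetric] left_diff_distrib)
  have "(\<Sum>x<M. (\<Sum>k<M. root_char M (int k * int x) * a k) * cnj (\<Sum>k<M. root_char M (int k * int x) * b k))
    = (\<Sum>x<M. \<Sum>k<M. \<Sum>l<M. root_char M ((int k - int l) * int x) * (a k * cnj (b l)))"
    unfolding diff by (simp add: sum_product mult_ac)
  also have "\<dots> = (\<Sum>k<M. \<Sum>l<M. (\<Sum>x<M. root_char M ((int k - int l) * int x)) * (a k * cnj (b l)))"
    unfolding sum_distrib_right by (rule sum_swap3)
  also have "\<dots> = (\<Sum>k<M. \<Sum>l<M. if k = l then of_nat M * (a k * cnj (b l)) else 0)"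
    by (intro sum.cong refl) (simp add: sum_root_char_diff)
  finally show ?thesis by (simp add: sum_distrib_left)
qed

section \<open>Positive semidefinite sesquilinear forms\<close>

text \<open>Vectors are functions of which only the first \<open>d\<close> values count; this avoids
  carrier conditions. The form is antilinear in the first argument.\<close>

definition inner_cv :: "nat \<Rightarrow> (nat \<Rightarrow> complex) \<Rightarrow> (nat \<Rightarrow> complex) \<Rightarrow> complex" where
  "inner_cv d u w = (\<Sum>i<d. cnj (u i) * w i)"

lemma cnj_inner_cv: "cnj (inner_cv d u w) = inner_cv d w u"
  by (simp add: inner_cv_def mult.commute)

lemma inner_cv_sum_right: "inner_cv d u (\<lambda>i. \<Sum>k\<in>K. c k * w k i) = (\<Sum>k\<in>K. c k * inner_cv d u (w k))"
  by (simp add: inner_cv_def sum_distrib_left sum.swap[of _ K] mult_ac)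

lemma inner_cv_sum_left: "inner_cv d (\<lambda>i. \<Sum>k\<in>K. c k * w k i) u = (\<Sum>k\<in>K. cnj (c k) * inner_cv d (w k) u)"
  by (simp add: inner_cv_def sum_distrib_left sum_distrib_right sum.swap[of _ K] mult_ac)

lemma inner_cv_scale_right: "inner_cv d u (\<lambda>i. c * w i) = c * inner_cv d u w"
  by (simp add: inner_cv_def sum_distrib_left mult_ac)

lemma inner_cv_scale_left: "inner_cv d (\<lambda>i. c * w i) u = cnj c * inner_cv d w u"
  by (simp add: inner_cv_def sum_distrib_left mult_ac)

lemma inner_cv_self: "inner_cv d u u = complex_of_real (\<Sum>i<d. (cmod (u i))\<^sup>2)"
  by (simp add: inner_cv_def complex_norm_square[symmetric] mult.commute)

definition sesq :: "nat \<Rightarrow> complex mat \<Rightarrow> (nat \<Rightarrow> complex) \<Rightarrow> (nat \<Rightarrow> complex) \<Rightarrow> complex" where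
  "sesq d E u w = (\<Sum>i<d. \<Sum>j<d. cnj (u i) * E $$ (i, j) * w j)"

lemma sesq_eq_scalar_prod:
  assumes "E \<in> carrier_mat d d"
  shows "conjugate (vec d u) \<bullet> (E *\<^sub>v vec d w) = sesq d E u w"
  using assms by (simp add: scalar_prod_def sesq_def lessThan_atLeast0 sum_distrib_left mult.assoc)

lemma psd_iff:
  "psd d E \<longleftrightarrow> E \<in> carrier_mat d d \<and> (\<forall>u. Im (sesq d E u u) = 0 \<and> Re (sesq d E u u) \<ge> 0)"
proof -
  have "v = vec d (\<lambda>i. v $ i)" if "v \<in> carrier_vec d" for v :: "complex vec"
    using that by auto
  then show ?thesis
    unfolding psd_def by (metis sesq_eq_scalar_prod vec_carrier)
qed

lemma sesq_add_right: "sesq d E u (\<lambda>i. a * v i + b * w i) = a * sesq d E u v + b * sesq d E u w"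
  by (simp add: sesq_def ring_distribs sum.distrib sum_distrib_left mult_ac)

lemma sesq_add_left: "sesq d E (\<lambda>i. a * v i + b * w i) u = cnj a * sesq d E v u + cnj b * sesq d E w u"
  by (simp add: sesq_def ring_distribs sum.distrib sum_distrib_left mult_ac)

lemma sesq_expand:
  "sesq d E (\<lambda>i. u i + c * w i) (\<lambda>i. u i + c * w i) =
    sesq d E u u + c * sesq d E u w + cnj c * sesq d E w u + cnj c * c * sesq d E w w"
  using sesq_add_right[of d E _ 1 u c w] sesq_add_left[of d E 1 u c w]
  by (simp add: algebra_simps)

text \<open>Polarization: the diagonal values at \<open>u + w\<close> and at
  \<open>u + \<i> w\<close> are real, which fixes the imaginary and the real parts
  respectively.\<close>

lemma psd_hermitian:
  assumes "psd d E" shows "sesq d E w u = cnj (sesq d E u w)"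
proof -
  have im: "Im (sesq d E v v) = 0" for v using assms by (simp add: psd_iff)
  have "Im (sesq d E u w) + Im (sesq d E w u) = 0"
    using im[of "\<lambda>i. u i + 1 * w i", unfolded sesq_expand] im[of u] im[of w] by simp
  moreover have "Re (sesq d E u w) - Re (sesq d E w u) = 0"
    using im[of "\<lambda>i. u i + \<i> * w i", unfolded sesq_expand] im[of u] im[of w] by simp
  ultimately show ?thesis by (simp add: complex_eq_iff)
qed

text \<open>Positivity at \<open>u + ?l * w\<close>, with \<open>?l\<close> a real multiple of the
  conjugate of \<open>?b\<close>, gives a real quadratic in \<open>s\<close> that is never
  negative.\<close>

lemma psd_Cauchy_Schwarz:
  assumes "psd d E"
  shows "(cmod (sesq d E u w))\<^sup>2 \<le> Re (sesq d E u u) * Re (sesq d E w w)"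
proof -
  let ?b = "sesq d E u w" and ?a = "Re (sesq d E u u)" and ?c = "Re (sesq d E w w)"
  have nonneg: "Re (sesq d E v v) \<ge> 0" for v using assms by (simp add: psd_iff)
  have quad: "?a - 2 * s * (cmod ?b)\<^sup>2 + s\<^sup>2 * (cmod ?b)\<^sup>2 * ?c \<ge> 0" for s :: real
  proof -
    let ?l = "- complex_of_real s * cnj ?b"
    have "Im (sesq d E w w) = 0" using assms by (simp add: psd_iff)
    then have "Re (sesq d E u u + ?l * ?b + cnj ?l * cnj ?b + cnj ?l * ?l * sesq d E w w)
      = ?a - 2 * s * (cmod ?b)\<^sup>2 + s\<^sup>2 * (cmod ?b)\<^sup>2 * ?c"
      unfolding cmod_power2 by (simp add: algebra_simps power2_eq_square)
    with nonneg[of "\<lambda>i. u i + ?l * w i", unfolded sesq_expand psd_hermitian[OF assms, of w u]]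
    show ?thesis by simp
  qed
  show ?thesis
  proof (cases "?c = 0")
    case True
    have "(cmod ?b)\<^sup>2 = 0"
    proof (rule ccontr)
      assume "(cmod ?b)\<^sup>2 \<noteq> 0"
      \<comment> \<open>With \<open>?c = 0\<close> the quadratic degenerates to an affine function
        of \<open>s\<close>; this value of \<open>s\<close> would bring it down to -1.\<close>
      then have "?a - 2 * ((?a + 1) / (2 * (cmod ?b)\<^sup>2)) * (cmod ?b)\<^sup>2 = - 1"
        by (simp add: field_simps)
      with quad[of "(?a + 1) / (2 * (cmod ?b)\<^sup>2)"] True show False by simp
    qed
    then show ?thesis using True by simp
  next
    case False
    then have c: "?c > 0" using nonneg[of w] by simp
    \<comment> \<open>The quadratic is evaluated at its minimizer \<open>s = 1 / ?c\<close>.\<close>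
    have "?a - (cmod ?b)\<^sup>2 / ?c \<ge> 0"
      using quad[of "1 / ?c"] c by (simp add: power2_eq_square field_simps)
    then show ?thesis using c by (simp add: field_simps)
  qed
qed

lemma sum_sesq_povm:
  assumes "povm d n E" shows "(\<Sum>y<n. sesq d (E y) u w) = inner_cv d u w"
proof -
  have "(\<Sum>y<n. E y $$ (i, j)) = (if i = j then 1 else 0)" if "i < d" "j < d" for i j
  proof -
    have "(\<Sum>y<n. E y $$ (i, j)) = msum d d E {..<n} $$ (i, j)"
      using that by (simp add: msum_def)
    also have "msum d d E {..<n} = 1\<^sub>m d" using assms by (simp add: povm_def)
    finally show ?thesis using that by simp
  qed
  then have *: "(\<Sum>y<n. E y $$ (i, j)) * w j = (if i = j then w j else 0)" if "i < d" "j < d" for i j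
    using that by simp
  have "(\<Sum>y<n. sesq d (E y) u w) = (\<Sum>i<d. \<Sum>j<d. cnj (u i) * ((\<Sum>y<n. E y $$ (i, j)) * w j))"
    unfolding sesq_def
    by (subst sum_swap3) (simp add: sum_distrib_left sum_distrib_right mult_ac)
  also have "\<dots> = (\<Sum>i<d. \<Sum>j<d. cnj (u i) * (if i = j then w j else 0))"
    by (intro sum.cong refl) (simp add: *)
  also have "\<dots> = inner_cv d u w"
    by (simp add: inner_cv_def if_distrib[of "\<lambda>c. _ * c"] cong: if_cong)
  finally show ?thesis .
qed

lemma mtrace_mult_proj:
  assumes E: "E \<in> carrier_mat d d" and V: "V \<in> carrier_mat d 1"
  shows "mtrace (E * proj V) = sesq d E (\<lambda>i. V $$ (i, 0)) (\<lambda>i. V $$ (i, 0))"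
proof -
  have "dim_row (proj V) = d" "dim_col (proj V) = d" using V by (auto simp: proj_def)
  then show ?thesis using E V
    by (simp add: mtrace_def sesq_def scalar_prod_def lessThan_atLeast0 proj_index[OF V] mult_ac)
qed

lemma sesq_rank_one:
  assumes "\<And>i j. i < d \<Longrightarrow> j < d \<Longrightarrow> E $$ (i, j) = f i * cnj (f j)"
  shows "sesq d E u u = complex_of_real ((cmod (inner_cv d f u))\<^sup>2)"
proof -
  have "sesq d E u u = cnj (inner_cv d f u) * inner_cv d f u"
    by (simp add: sesq_def inner_cv_def assms sum_product mult_ac)
  then show ?thesis by (simp only: complex_norm_square mult.commute)
qed

section \<open>Vectors with circulant Gram matrix\<close>

text \<open>The inequality \<open>ln z \<le> z - 1\<close> at \<open>z = 1 / sqrt y\<close> gives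
  the lower bound \<open>(sqrt y - 1)^2\<close>. Rationalizing it produces a quadratic bound that is
  uniform on the interval up to \<open>K\<close>.\<close>

lemma xlnx_lower:
  fixes y :: real
  assumes "0 < y" "y \<le> K"
  shows "y * ln y - y + 1 \<ge> (y - 1)\<^sup>2 / (sqrt K + 1)\<^sup>2"
proof -
  let ?s = "sqrt y"
  have s: "?s > 0" "?s\<^sup>2 = y" using assms by auto
  have "ln (1 / ?s) \<le> 1 / ?s - 1" using s by (intro ln_le_minus_one) simp
  then have "2 * y * ln (1 / ?s) \<le> 2 * y * (1 / ?s - 1)" using assms by (intro mult_left_mono) auto
  moreover have "ln (1 / ?s) = - (ln y / 2)" using assms by (simp add: ln_div ln_sqrt)
  moreover have "2 * y * (1 / ?s - 1) = 2 * ?s - 2 * y"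
  proof -
    have "y * (1 / ?s) = ?s" using s by (simp add: field_simps power2_eq_square)
    then show ?thesis by (simp add: right_diff_distrib)
  qed
  ultimately have "y * ln y - y + 1 \<ge> y - 2 * ?s + 1" by (simp add: algebra_simps)
  also have "y - 2 * ?s + 1 = (?s - 1)\<^sup>2" using s by (simp add: power2_diff)
  finally have "(?s - 1)\<^sup>2 \<le> y * ln y - y + 1" .
  moreover have "(y - 1)\<^sup>2 / (sqrt K + 1)\<^sup>2 \<le> (y - 1)\<^sup>2 / (?s + 1)\<^sup>2"
    using assms s by (intro divide_left_mono power_mono mult_pos_pos zero_less_power add_mono) (auto intro: add_pos_nonneg)
  moreover have "(y - 1)\<^sup>2 / (?s + 1)\<^sup>2 = (?s - 1)\<^sup>2"
  proof -
    have "y - 1 = (?s - 1) * (?s + 1)" using s by (simp add: algebra_simps power2_eq_square)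
    moreover have "?s + 1 \<noteq> 0" using s(1) by linarith
    ultimately show ?thesis by (simp add: power_mult_distrib)
  qed
  ultimately show ?thesis by linarith
qed

text \<open>Everything about entropy and measurement depends only on the circulant Gram matrix, so
  the tensor structure is abstracted away. \<open>R\<close> is the largest overlap between distinct
  orbit vectors.\<close>

locale cyclic_orbit =
  fixes M d :: nat and v :: "nat \<Rightarrow> nat \<Rightarrow> complex" and s :: "int \<Rightarrow> complex" and R :: real
  assumes M: "M \<ge> 2"
    and gram: "\<And>a b. a < M \<Longrightarrow> b < M \<Longrightarrow> inner_cv d (v a) (v b) = s (int b - int a)"
    and s_mod: "\<And>z. s (z mod int M) = s z"
    and s_0: "s 0 = 1"
    and s_le: "\<And>n. n \<in> {1..<M} \<Longrightarrow> cmod (s (int n)) \<le> R"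
    and attained: "\<exists>n\<in>{1..<M}. cmod (s (int n)) = R"
begin

text \<open>The charge sector \<open>k\<close> of the orbit: the part of \<open>v x\<close> that
  carries the phase \<open>root_char M (int k * int x)\<close>.\<close>

definition phi :: "nat \<Rightarrow> nat \<Rightarrow> complex" where
  "phi k i = (1 / of_nat M) * (\<Sum>x<M. root_char M (- (int k * int x)) * v x i)"

definition P :: "nat \<Rightarrow> real" where
  "P k = (\<Sum>i<d. (cmod (phi k i))\<^sup>2)"

text \<open>Up to the factor \<open>M\<close> these are the eigenvalues of the circulant Gram
  matrix. They turn out to equal \<open>P k\<close>, hence to be real and nonnegative.\<close>

definition dft :: "nat \<Rightarrow> complex" where
  "dft k = (1 / of_nat M) * (\<Sum>n<M. root_char M (- (int k * int n)) * s (int n))"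

lemma M_pos: "M > 0" and M_nz: "complex_of_nat M \<noteq> 0"
  using M by auto

lemma s_eq_sum_dft: "s z = (\<Sum>k<M. root_char M (int k * z) * dft k)"
proof -
  have dvd: "int M dvd z - int n \<longleftrightarrow> n = nat (z mod int M)" if "n < M" for n
    using that M_pos by (metis int_nat_eq mod_eq_dvd_iff mod_pos_pos_trivial nat_int of_nat_0_le_iff
        of_nat_less_iff pos_mod_sign of_nat_0_less_iff)
  have ch: "root_char M (int k * z) * root_char M (- (int k * int n)) = root_char M ((z - int n) * int k)" for k n
    by (simp add: root_char_add[symmetric] algebra_simps)
  have "(\<Sum>k<M. root_char M (int k * z) * dft k)
      = (1 / of_nat M) * (\<Sum>k<M. \<Sum>n<M. (root_char M (int k * z) * root_char M (- (int k * int n))) * s (int n))"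
    by (simp add: dft_def sum_distrib_left mult_ac)
  also have "\<dots> = (1 / of_nat M) * (\<Sum>n<M. (\<Sum>k<M. root_char M ((z - int n) * int k)) * s (int n))"
    unfolding ch by (subst sum.swap) (simp add: sum_distrib_right)
  also have "\<dots> = (1 / of_nat M) * (\<Sum>n<M. if n = nat (z mod int M) then of_nat M * s (int n) else 0)"
    by (intro arg_cong2[where f = "(*)"] sum.cong refl) (simp add: sum_root_char[OF M_pos] dvd)
  also have "\<dots> = s z" using M_pos by (simp add: nat_less_iff s_mod)
  finally show ?thesis ..
qed

lemma sum_root_char_neg:
  assumes "k < M" "l < M"
  shows "(\<Sum>x<M. root_char M (int k * int x) * root_char M (- (int l * int x))) = (if k = l then of_nat M else 0)"
  unfolding sum_root_char_diff[OF assms, symmetric] by (simp add: root_char_add[symmetric] left_diff_distrib)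

text \<open>Characters diagonalize a circulant matrix: after Fourier inversion of \<open>s\<close>,
  the sum over \<open>y\<close> leaves only the frequency \<open>k\<close>.\<close>

lemma inner_phi_v:
  assumes "k < M" "x < M"
  shows "inner_cv d (phi k) (v x) = root_char M (int k * int x) * dft k"
proof -
  have "inner_cv d (phi k) (v x)
      = (1 / of_nat M) * (\<Sum>y<M. root_char M (int k * int y) * s (int x - int y))"
    unfolding phi_def inner_cv_scale_left inner_cv_sum_left using assms by (simp add: gram)
  also have "\<dots> = (1 / of_nat M) * (\<Sum>y<M. \<Sum>l<M.
      (root_char M (int k * int y) * root_char M (- (int l * int y))) * (root_char M (int l * int x) * dft l))"
    unfolding s_eq_sum_dft[of "int x - int _"] sum_distrib_left right_diff_distrib
    by (simp add: root_char_add[of M _ "- _", simplified] mult_ac)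
  also have "\<dots> = (1 / of_nat M) * (\<Sum>l<M. if k = l then of_nat M * (root_char M (int l * int x) * dft l) else 0)"
    by (subst sum.swap, intro arg_cong2[where f = "(*)"] sum.cong refl)
      (simp add: sum_distrib_right[symmetric] sum_root_char_neg assms)
  also have "\<dots> = root_char M (int k * int x) * dft k" using assms M_pos by simp
  finally show ?thesis .
qed

lemma inner_phi:
  assumes "k < M" "l < M"
  shows "inner_cv d (phi k) (phi l) = (if k = l then dft k else 0)"
proof -
  have "inner_cv d (phi k) (phi l) = (1 / of_nat M) *
      (\<Sum>x<M. root_char M (- (int l * int x)) * (root_char M (int k * int x) * dft k))"
    unfolding phi_def[of l] inner_cv_scale_right inner_cv_sum_right using assms by (simp add: inner_phi_v)
  also have "\<dots> = (1 / of_nat M) * ((\<Sum>x<M. root_char M (int k * int x) * root_char M (- (int l * int x))) * dft k)"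
    by (simp add: sum_distrib_left sum_distrib_right mult_ac)
  finally show ?thesis using M_pos assms by (simp add: sum_root_char_neg)
qed

lemma dft_eq_P: "k < M \<Longrightarrow> dft k = complex_of_real (P k)"
  using inner_phi[of k k] by (simp add: inner_cv_self P_def)

lemma P_nonneg: "P k \<ge> 0"
  by (simp add: P_def sum_nonneg)

lemma s_eq_sum_P: "s z = (\<Sum>k<M. root_char M (int k * z) * complex_of_real (P k))"
  by (simp add: s_eq_sum_dft dft_eq_P)

lemma sum_P: "(\<Sum>k<M. P k) = 1"
proof -
  have "complex_of_real (\<Sum>k<M. P k) = 1" using s_eq_sum_P[of 0] s_0 by simp
  then show ?thesis by (simp only: of_real_eq_1_iff)
qed

lemma R_nonneg: "R \<ge> 0"
  using attained norm_ge_zero by metis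

lemma sum_lessThan_split0: "(\<Sum>n<M. f n) = f 0 + (\<Sum>n\<in>{1..<M}. f n)" for f :: "nat \<Rightarrow> 'b :: comm_monoid_add"
  using M_pos by (simp add: lessThan_atLeast0 sum.atLeast_Suc_lessThan)

text \<open>The frequency \<open>n = 0\<close> contributes exactly \<open>1 / M\<close> to
  \<open>P k\<close>; the remaining \<open>M - 1\<close> terms have modulus at most \<open>R\<close>
  each.\<close>

lemma P_dev:
  assumes "k < M" shows "\<bar>P k - 1 / real M\<bar> \<le> R"
proof -
  have "complex_of_real (P k - 1 / real M)
      = (1 / of_nat M) * (\<Sum>n\<in>{1..<M}. root_char M (- (int k * int n)) * s (int n))"
    using M_pos by (simp add: dft_eq_P[OF assms, symmetric] dft_def sum_lessThan_split0 s_0 field_simps)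
  from arg_cong[OF this, of cmod]
  have "\<bar>P k - 1 / real M\<bar> = (1 / real M) * cmod (\<Sum>n\<in>{1..<M}. root_char M (- (int k * int n)) * s (int n))"
    by (simp only: norm_mult norm_of_real norm_divide norm_one norm_of_nat)
  also have "\<dots> \<le> (1 / real M) * (of_nat (card {1..<M}) * R)"
    by (intro mult_left_mono order_trans[OF norm_sum sum_bounded_above]) (use s_le in \<open>auto simp: norm_mult\<close>)
  also have "\<dots> \<le> (1 / real M) * (real M * R)"
    using R_nonneg by (intro mult_left_mono mult_right_mono) auto
  also have "\<dots> = R" using M_pos by simp
  finally show ?thesis .
qed

lemma sum_root_char_nontrivial:
  assumes "\<not> int M dvd z" shows "(\<Sum>k<M. root_char M (int k * z)) = 0"
  using sum_root_char[OF M_pos, of z] assms by (simp add: mult.commute)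

text \<open>At a frequency where \<open>R\<close> is attained, the uniform part of \<open>P\<close>
  cancels in the Fourier sum. So \<open>R\<close> is at most the sum of all deviations, and the
  \<open>M\<close> of them cannot all be smaller than \<open>R / M\<close>.\<close>

lemma ex_P_dev: "\<exists>k<M. R / real M \<le> \<bar>P k - 1 / real M\<bar>"
proof (rule ccontr)
  assume *: "\<not> ?thesis"
  obtain n where n: "n \<in> {1..<M}" "cmod (s (int n)) = R" using attained by blast
  then have "\<not> int M dvd int n" by (auto dest: nat_dvd_not_less)
  then have "s (int n) = (\<Sum>k<M. root_char M (int k * int n) * complex_of_real (P k))
      - (\<Sum>k<M. root_char M (int k * int n)) * complex_of_real (1 / real M)"
    by (simp add: s_eq_sum_P sum_root_char_nontrivial)
  also have "\<dots> = (\<Sum>k<M. root_char M (int k * int n) * complex_of_real (P k - 1 / real M))"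
    by (simp add: sum_distrib_right sum_divide_distrib sum_subtractf[symmetric] right_diff_distrib)
  finally have "R \<le> (\<Sum>k<M. \<bar>P k - 1 / real M\<bar>)"
    using norm_sum[of "\<lambda>k. root_char M (int k * int n) * complex_of_real (P k - 1 / real M)" "{..<M}"] n(2)
    by (simp add: norm_mult del: of_real_diff)
  also have "\<dots> < (\<Sum>k<M. R / real M)"
    using * M_pos by (intro sum_strict_mono) (auto simp: not_le)
  finally show False using M_pos by simp
qed

section \<open>Entropy deficit as the relative entropy of \<open>P\<close> to the uniform
  distribution\<close>

lemma entropy_deficit:
  "log 2 M + (\<Sum>k<M. eta (P k)) = (\<Sum>k<M. if P k = 0 then 0 else P k * ln (real M * P k)) / ln 2"
proof -
  have "log 2 M + (\<Sum>k<M. eta (P k)) = (\<Sum>k<M. P k * log 2 M + eta (P k))"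
    by (simp add: sum.distrib sum_distrib_right[symmetric] sum_P)
  also have "\<dots> = (\<Sum>k<M. (if P k = 0 then 0 else P k * ln (real M * P k)) / ln 2)"
  proof (intro sum.cong refl)
    fix k
    show "P k * log 2 M + eta (P k) = (if P k = 0 then 0 else P k * ln (real M * P k)) / ln 2"
      using P_nonneg[of k] M_pos by (auto simp: eta_def log_def ln_mult field_simps)
  qed
  finally show ?thesis by (simp add: sum_divide_distrib)
qed

text \<open>By \<open>ln z \<le> z - 1\<close> at \<open>z = M * P k\<close>, relative entropy is at
  most the chi-squared distance; the linear terms cancel because \<open>P\<close> sums to 1.\<close>

lemma entropy_upper: "log 2 M + (\<Sum>k<M. eta (P k)) \<le> (real M)\<^sup>2 * R\<^sup>2 / ln 2"
proof -
  have "(if P k = 0 then 0 else P k * ln (real M * P k)) \<le> P k * (real M * P k - 1)" for k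
    using P_nonneg[of k] M_pos by (auto intro!: mult_left_mono ln_le_minus_one mult_pos_pos)
  then have "(\<Sum>k<M. if P k = 0 then 0 else P k * ln (real M * P k)) \<le> (\<Sum>k<M. P k * (real M * P k - 1))"
    by (intro sum_mono) auto
  also have "\<dots> = (\<Sum>k<M. real M * (P k - 1 / real M)\<^sup>2 + (P k - 1 / real M))"
    using M_pos by (intro sum.cong refl) (simp add: power2_eq_square field_simps)
  also have "\<dots> = (\<Sum>k<M. real M * (P k - 1 / real M)\<^sup>2)"
    using M_pos by (simp add: sum.distrib sum_subtractf sum_P)
  also have "\<dots> \<le> of_nat (card {..<M}) * (real M * R\<^sup>2)"
    using P_dev by (intro sum_bounded_above mult_left_mono) (auto simp: abs_le_square_iff[symmetric] R_nonneg)
  also have "\<dots> = (real M)\<^sup>2 * R\<^sup>2" by (simp add: power2_eq_square)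
  finally show ?thesis unfolding entropy_deficit by (intro divide_right_mono) auto
qed

lemma P_le_1: "k < M \<Longrightarrow> P k \<le> 1"
  unfolding sum_P[symmetric] using P_nonneg by (intro member_le_sum) auto

lemma entropy_lower:
  "R\<^sup>2 / (real M * (sqrt M + 1)\<^sup>2 * ln 2) \<le> log 2 M + (\<Sum>k<M. eta (P k))"
proof -
  let ?K = "(sqrt M + 1)\<^sup>2"
  have K: "?K \<ge> 1" by (simp add: one_le_power)
  \<comment> \<open>The subtracted \<open>P k - 1 / real M\<close> sums to zero over
    \<open>k\<close> but makes every term nonnegative, so a single deviating \<open>k\<close> can be
    isolated.\<close>
  have term_bound: "(real M * P k - 1)\<^sup>2 / ?K / real M
      \<le> (if P k = 0 then 0 else P k * ln (real M * P k)) - (P k - 1 / real M)" if "k < M" for k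
  proof (cases "P k = 0")
    case True
    have "1 / ?K \<le> 1" using divide_le_eq_1_pos[of ?K 1] K by linarith
    from divide_right_mono[OF this, of "real M"] show ?thesis using True by simp
  next
    case False
    let ?y = "real M * P k"
    have "0 < ?y" "?y \<le> real M" using False P_nonneg[of k] M_pos P_le_1[OF that] by auto
    from xlnx_lower[OF this]
    have "(?y - 1)\<^sup>2 / ?K / real M \<le> (?y * ln ?y - ?y + 1) / real M"
      by (intro divide_right_mono) auto
    also have "\<dots> = P k * ln ?y - (P k - 1 / real M)" using M_pos by (simp add: field_simps)
    finally show ?thesis using False by simp
  qed
  obtain k where k: "k < M" "R / real M \<le> \<bar>P k - 1 / real M\<bar>" using ex_P_dev by blast
  have "R / real M * real M \<le> \<bar>P k - 1 / real M\<bar> * real M" using k(2) by (intro mult_right_mono) auto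
  also have "\<dots> = \<bar>real M * P k - 1\<bar>"
  proof -
    have "real M * P k - 1 = (P k - 1 / real M) * real M" using M_pos by (simp add: field_simps)
    then show ?thesis by (simp only: abs_mult abs_of_nat)
  qed
  finally have "R \<le> \<bar>real M * P k - 1\<bar>" using M_pos by simp
  then have "R\<^sup>2 \<le> (real M * P k - 1)\<^sup>2" using R_nonneg by (simp add: abs_le_square_iff[symmetric])
  then have "R\<^sup>2 / ?K / real M \<le> (real M * P k - 1)\<^sup>2 / ?K / real M"
    by (intro divide_right_mono) auto
  also have "\<dots> \<le> (\<Sum>k<M. (real M * P k - 1)\<^sup>2 / ?K / real M)"
    using k by (intro member_le_sum[of _ _ "\<lambda>k. (real M * P k - 1)\<^sup>2 / ?K / real M"]) auto
  also have "\<dots> \<le> (\<Sum>k<M. (if P k = 0 then 0 else P k * ln (real M * P k)) - (P k - 1 / real M))"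
    by (intro sum_mono term_bound) simp
  also have "\<dots> = (\<Sum>k<M. if P k = 0 then 0 else P k * ln (real M * P k))"
    using M_pos by (simp add: sum_subtractf sum_P)
  finally have "R\<^sup>2 / ?K / real M / ln 2 \<le> log 2 M + (\<Sum>k<M. eta (P k))"
    unfolding entropy_deficit by (intro divide_right_mono) auto
  then show ?thesis by (simp add: mult_ac)
qed

section \<open>Charge decomposition of the orbit and the covariant Fourier measurement\<close>

lemma v_eq_sum_phi:
  assumes "x < M" shows "v x i = (\<Sum>k<M. root_char M (int k * int x) * phi k i)"
proof -
  have "(\<Sum>k<M. root_char M (int k * int x) * phi k i) = (1 / of_nat M) *
      (\<Sum>k<M. \<Sum>y<M. (root_char M (int x * int k) * root_char M (- (int y * int k))) * v y i)"
    by (simp add: phi_def sum_distrib_left mult_ac)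
  also have "\<dots> = (1 / of_nat M) * (\<Sum>y<M. if x = y then of_nat M * v y i else 0)"
    by (subst sum.swap, intro arg_cong2[where f = "(*)"] sum.cong refl)
      (simp add: sum_distrib_right[symmetric] sum_root_char_neg assms)
  also have "\<dots> = v x i" using assms M_pos by simp
  finally show ?thesis ..
qed

text \<open>Averaging over the group erases the coherence between different charges. This identifies
  the twirled state as a sum of \<open>M\<close> mutually orthogonal rank-one terms.\<close>

lemma sum_v_outer: "(\<Sum>x<M. v x i * cnj (v x j)) = of_nat M * (\<Sum>k<M. phi k i * cnj (phi k j))"
  unfolding parseval_root_char[symmetric] by (intro sum.cong refl arg_cong2[where f = "(*)"])
    (simp_all add: v_eq_sum_phi[symmetric])

text \<open>Normalized components; a component that vanishes is left at zero by division by zero.\<close>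

definition W :: "nat \<Rightarrow> nat \<Rightarrow> complex" where
  "W k i = complex_of_real (1 / sqrt (P k)) * phi k i"

text \<open>These are the vectors of the square-root measurement: the inverse square root of the sum
  of the orbit projectors, taken on its support and applied to \<open>v y\<close>.\<close>

definition Phi :: "nat \<Rightarrow> nat \<Rightarrow> complex" where
  "Phi y i = complex_of_real (1 / sqrt M) * (\<Sum>k<M. root_char M (int k * int y) * W k i)"

text \<open>Outcome \<open>M\<close> is the projector onto the complement of the span of the
  \<open>W k\<close>, which completes the effects to the identity.\<close>

definition fourier_povm :: "nat \<Rightarrow> complex mat" where
  "fourier_povm y = mat d d (\<lambda>(i, j). if y < M then Phi y i * cnj (Phi y j)
     else (if i = j then 1 else 0) - (\<Sum>k<M. W k i * cnj (W k j)))"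

lemma inner_W:
  assumes "k < M" "l < M"
  shows "inner_cv d (W k) (W l) = (if k = l \<and> P k \<noteq> 0 then 1 else 0)"
proof -
  have "complex_of_real (1 / sqrt (P k)) * (complex_of_real (1 / sqrt (P k)) * complex_of_real (P k)) = 1" if "P k \<noteq> 0"
    unfolding of_real_mult[symmetric] using that P_nonneg[of k] by (simp add: divide_simps)
  then show ?thesis
    unfolding W_def inner_cv_scale_left inner_cv_scale_right using assms by (auto simp: inner_phi dft_eq_P)
qed

lemma inner_W_v:
  assumes "k < M" "x < M"
  shows "inner_cv d (W k) (v x) = root_char M (int k * int x) * complex_of_real (sqrt (P k))"
proof -
  have "complex_of_real (1 / sqrt (P k)) * complex_of_real (P k) = complex_of_real (sqrt (P k))"
    unfolding of_real_mult[symmetric] using P_nonneg[of k] by (simp add: real_div_sqrt)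
  moreover have "inner_cv d (W k) (v x) = root_char M (int k * int x) *
      (complex_of_real (1 / sqrt (P k)) * complex_of_real (P k))"
    unfolding W_def inner_cv_scale_left using assms by (simp add: inner_phi_v dft_eq_P mult_ac)
  ultimately show ?thesis by simp
qed

lemma sum_Phi_outer: "(\<Sum>y<M. Phi y i * cnj (Phi y j)) = (\<Sum>k<M. W k i * cnj (W k j))"
proof -
  let ?S = "\<lambda>y i. \<Sum>k<M. root_char M (int k * int y) * W k i"
  have "Phi y i * cnj (Phi y j) = (complex_of_real (1 / sqrt M) * complex_of_real (1 / sqrt M)) * (?S y i * cnj (?S y j))" for y
    unfolding Phi_def by (simp only: complex_cnj_mult complex_cnj_complex_of_real mult_ac)
  moreover have "complex_of_real (1 / sqrt M) * complex_of_real (1 / sqrt M) = 1 / of_nat M"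
    unfolding of_real_mult[symmetric] using M_pos by simp
  ultimately have "(\<Sum>y<M. Phi y i * cnj (Phi y j)) = 1 / of_nat M * (\<Sum>y<M. ?S y i * cnj (?S y j))"
    by (simp only: sum_distrib_left)
  then show ?thesis unfolding parseval_root_char using M_pos by simp
qed

lemma sesq_complement:
  assumes "\<not> y < M"
  shows "sesq d (fourier_povm y) u u = inner_cv d u u - (\<Sum>k<M. complex_of_real ((cmod (inner_cv d (W k) u))\<^sup>2))"
proof -
  have "sesq d (fourier_povm y) u u = (\<Sum>i<d. \<Sum>j<d. cnj (u i) * (if i = j then u j else 0))
      - (\<Sum>i<d. \<Sum>j<d. \<Sum>k<M. (cnj (u i) * W k i) * (cnj (W k j) * u j))"
    using assms unfolding sesq_def sum_subtractf[symmetric]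
    by (intro sum.cong refl)
      (simp add: fourier_povm_def right_diff_distrib left_diff_distrib sum_distrib_left sum_distrib_right mult_ac)
  also have "(\<Sum>i<d. \<Sum>j<d. cnj (u i) * (if i = j then u j else 0)) = inner_cv d u u"
    by (simp add: inner_cv_def if_distrib[of "\<lambda>c. _ * c"] cong: if_cong)
  also have "(\<Sum>i<d. \<Sum>j<d. \<Sum>k<M. (cnj (u i) * W k i) * (cnj (W k j) * u j))
      = (\<Sum>k<M. inner_cv d u (W k) * inner_cv d (W k) u)"
    unfolding inner_cv_def sum_product by (rule sum_swap3[symmetric])
  also have "\<dots> = (\<Sum>k<M. complex_of_real ((cmod (inner_cv d (W k) u))\<^sup>2))"
    by (intro sum.cong refl) (metis cnj_inner_cv complex_norm_square mult.commute)
  finally show ?thesis .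
qed

text \<open>The difference of the two sides is the squared norm of \<open>u\<close> minus its
  projection \<open>w\<close>.\<close>

lemma bessel_W: "(\<Sum>k<M. (cmod (inner_cv d (W k) u))\<^sup>2) \<le> (\<Sum>i<d. (cmod (u i))\<^sup>2)"
proof -
  define c where "c k = inner_cv d (W k) u" for k
  define w where "w i = (\<Sum>k<M. c k * W k i)" for i
  \<comment> \<open>Some \<open>W k\<close> may be zero instead of a unit vector. Their coefficients
    vanish too, so \<open>w\<close> still has the coefficients \<open>c k\<close>.\<close>
  have c0: "c k = 0" if "P k = 0" for k
    using that by (simp add: c_def W_def inner_cv_def)
  have w_left: "inner_cv d w z = (\<Sum>k<M. cnj (c k) * inner_cv d (W k) z)" for z
    unfolding w_def inner_cv_sum_left ..
  then have wu: "inner_cv d w u = (\<Sum>k<M. cnj (c k) * c k)"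
    by (simp add: c_def)
  have Ww: "inner_cv d (W k) w = c k" if "k < M" for k
  proof -
    have "inner_cv d (W k) w = (\<Sum>l<M. if k = l then c l else 0)"
      unfolding w_def inner_cv_sum_right using that c0 by (intro sum.cong refl) (auto simp: inner_W)
    then show ?thesis using that by simp
  qed
  have ww: "inner_cv d w w = (\<Sum>k<M. cnj (c k) * c k)"
    unfolding w_left[of w] by (simp add: Ww)
  have uw: "inner_cv d u w = (\<Sum>k<M. cnj (c k) * c k)"
    using arg_cong[OF wu, of cnj] unfolding cnj_inner_cv by (simp add: mult.commute)
  have "inner_cv d (\<lambda>i. u i - w i) (\<lambda>i. u i - w i)
      = inner_cv d u u - inner_cv d u w - inner_cv d w u + inner_cv d w w"
    by (simp add: inner_cv_def algebra_simps sum.distrib sum_subtractf)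
  also have "\<dots> = complex_of_real ((\<Sum>i<d. (cmod (u i))\<^sup>2) - (\<Sum>k<M. (cmod (c k))\<^sup>2))"
    unfolding wu uw ww unfolding inner_cv_self by (simp add: complex_norm_square[symmetric] mult.commute)
  finally have "(\<Sum>i<d. (cmod (u i - w i))\<^sup>2) = (\<Sum>i<d. (cmod (u i))\<^sup>2) - (\<Sum>k<M. (cmod (c k))\<^sup>2)"
    unfolding inner_cv_self of_real_eq_iff .
  moreover have "(\<Sum>i<d. (cmod (u i - w i))\<^sup>2) \<ge> 0" by (intro sum_nonneg) auto
  ultimately show ?thesis unfolding c_def by simp
qed

lemma povm_fourier: "povm d (Suc M) fourier_povm"
  unfolding povm_def
proof (intro conjI allI impI)
  fix y
  show "psd d (fourier_povm y)"
  proof (cases "y < M")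
    case True
    then have "sesq d (fourier_povm y) u u = complex_of_real ((cmod (inner_cv d (Phi y) u))\<^sup>2)" for u
      by (intro sesq_rank_one) (simp add: fourier_povm_def)
    then show ?thesis by (simp add: psd_iff fourier_povm_def)
  next
    case False
    have "sesq d (fourier_povm y) u u = complex_of_real
       ((\<Sum>i<d. (cmod (u i))\<^sup>2) - (\<Sum>k<M. (cmod (inner_cv d (W k) u))\<^sup>2))" for u
      using sesq_complement[OF False] by (simp add: inner_cv_self)
    then show ?thesis using bessel_W
      by (simp add: psd_iff fourier_povm_def del: of_real_diff of_real_sum)
  qed
next
  show "msum d d fourier_povm {..<Suc M} = 1\<^sub>m d"
    by (rule eq_matI) (auto simp: msum_def fourier_povm_def sum_Phi_outer)
qed

section \<open>Outcome statistics and bounds on the accessible information\<close>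

definition outcome :: "(nat \<Rightarrow> complex mat) \<Rightarrow> nat \<Rightarrow> nat \<Rightarrow> real" where
  "outcome E x y = 1 / real M * Re (sesq d (E y) (v x) (v x))"

lemma outcome_nonneg: "povm d n E \<Longrightarrow> y < n \<Longrightarrow> outcome E x y \<ge> 0"
  by (simp add: outcome_def povm_def psd_iff)

lemma sum_outcome:
  assumes "povm d n E" "x < M" shows "(\<Sum>y<n. outcome E x y) = 1 / real M"
proof -
  have "(\<Sum>y<n. outcome E x y) = 1 / real M * Re (\<Sum>y<n. sesq d (E y) (v x) (v x))"
    by (simp add: outcome_def sum_distrib_left)
  then show ?thesis using assms by (simp add: sum_sesq_povm gram s_0)
qed

text \<open>Inserting the resolution of the identity into an inner product of modulus
  \<open>R\<close> and applying Cauchy-Schwarz to each effect forces the outcome distributions of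
  these two states to overlap.\<close>

lemma mutual_info_outcome_le:
  assumes "povm d n E"
  shows "mutual_info M n (outcome E) \<le> log 2 M - 2 * R\<^sup>2 / ((real M)\<^sup>2 * ln 2)"
proof -
  obtain b where b: "b \<in> {1..<M}" "cmod (s (int b)) = R" using attained by blast
  then have b': "0 < M" "b < M" "0 \<noteq> b" by auto
  have "R = cmod (inner_cv d (v 0) (v b))" using b b' by (simp add: gram)
  also have "\<dots> = cmod (\<Sum>y<n. sesq d (E y) (v 0) (v b))"
    by (simp add: sum_sesq_povm[OF assms])
  also have "\<dots> \<le> (\<Sum>y<n. real M * sqrt (outcome E 0 y * outcome E b y))"
  proof (rule order_trans[OF norm_sum], rule sum_mono)
    fix y assume "y \<in> {..<n}"
    then have "psd d (E y)" using assms by (simp add: povm_def)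
    from psd_Cauchy_Schwarz[OF this, of "v 0" "v b"]
    have "(cmod (sesq d (E y) (v 0) (v b)))\<^sup>2 \<le> (real M)\<^sup>2 * (outcome E 0 y * outcome E b y)"
      using M_pos by (simp add: outcome_def power2_eq_square)
    then have "cmod (sesq d (E y) (v 0) (v b)) \<le> sqrt ((real M)\<^sup>2 * (outcome E 0 y * outcome E b y))"
      by (rule real_le_rsqrt)
    then show "cmod (sesq d (E y) (v 0) (v b)) \<le> real M * sqrt (outcome E 0 y * outcome E b y)"
      by (simp add: real_sqrt_mult)
  qed
  finally have "R / real M \<le> (\<Sum>y<n. sqrt (outcome E 0 y * outcome E b y))"
    using M_pos by (simp add: sum_distrib_left[symmetric] field_simps)
  then have "(R / real M)\<^sup>2 \<le> (\<Sum>y<n. sqrt (outcome E 0 y * outcome E b y))\<^sup>2"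
    using R_nonneg by (intro power_mono) auto
  then have "2 / ln 2 * (R / real M)\<^sup>2 \<le> 2 / ln 2 * (\<Sum>y<n. sqrt (outcome E 0 y * outcome E b y))\<^sup>2"
    by (intro mult_left_mono) auto
  moreover have "mutual_info M n (outcome E) \<le> log 2 M - 2 / ln 2 * (\<Sum>y<n. sqrt (outcome E 0 y * outcome E b y))\<^sup>2"
    using b' outcome_nonneg[OF assms] sum_outcome[OF assms] by (intro mutual_info_le_overlap) auto
  ultimately show ?thesis by (simp add: power_divide mult_ac)
qed

text \<open>For uniform \<open>P\<close> the amplitude of a wrong outcome would vanish by
  orthogonality of characters. In general it is controlled by the deviations of
  \<open>sqrt (P k)\<close> from uniformity, which are of order \<open>R\<close>.\<close>

lemma fourier_outcome_error:
  assumes x: "x < M" and y: "y < Suc M" and neq: "x \<noteq> y"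
  shows "outcome fourier_povm x y \<le> real M * R\<^sup>2"
proof (cases "y < M")
  case True
  have neg: "root_char M (int k * (int x - int y)) = root_char M (- (int k * int y)) * root_char M (int k * int x)" for k
    by (simp add: root_char_add[symmetric] right_diff_distrib)
  have "inner_cv d (Phi y) (v x) = complex_of_real (1 / sqrt M) *
      (\<Sum>k<M. root_char M (int k * (int x - int y)) * complex_of_real (sqrt (P k)))"
    unfolding Phi_def inner_cv_scale_left inner_cv_sum_left neg
    using x by (simp add: inner_W_v mult.assoc)
  also have "(\<Sum>k<M. root_char M (int k * (int x - int y)) * complex_of_real (sqrt (P k)))
      = (\<Sum>k<M. root_char M (int k * (int x - int y)) * complex_of_real (sqrt (P k) - sqrt (1 / real M)))"
    using sum_root_char_nontrivial[of "int x - int y"] int_dvd_diff_iff[OF x True] neq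
    by (simp add: right_diff_distrib sum_subtractf sum_distrib_right[symmetric])
  finally have inner: "cmod (inner_cv d (Phi y) (v x)) = 1 / sqrt M *
      cmod (\<Sum>k<M. root_char M (int k * (int x - int y)) * complex_of_real (sqrt (P k) - sqrt (1 / real M)))"
    by (simp add: norm_mult norm_divide del: of_real_diff)
  \<comment> \<open>Write the difference of roots as \<open>P k - 1 / real M\<close> over the sum of
    roots; that sum is at least \<open>sqrt (1 / real M)\<close>, even when
    \<open>P k = 0\<close>.\<close>
  have sq: "\<bar>sqrt (P k) - sqrt (1 / real M)\<bar> \<le> sqrt M * R" if "k < M" for k
  proof -
    let ?a = "sqrt (P k)" and ?b = "sqrt (1 / real M)"
    have b: "?b > 0" using M_pos by simp
    have "\<bar>?a - ?b\<bar> * ?b \<le> \<bar>?a - ?b\<bar> * \<bar>?a + ?b\<bar>"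
      using P_nonneg[of k] by (intro mult_left_mono) auto
    also have "\<dots> = \<bar>P k - 1 / real M\<bar>"
    proof -
      have "(?a - ?b) * (?a + ?b) = ?a\<^sup>2 - ?b\<^sup>2" by (simp add: power2_eq_square algebra_simps)
      also have "\<dots> = P k - 1 / real M" using P_nonneg[of k] by simp
      finally show ?thesis by (simp only: abs_mult[symmetric])
    qed
    also have "\<dots> \<le> R" by (rule P_dev[OF that])
    finally have "\<bar>?a - ?b\<bar> \<le> R / ?b" using b by (simp add: pos_le_divide_eq)
    then show ?thesis by (simp add: real_sqrt_divide mult.commute)
  qed
  have "cmod (\<Sum>k<M. root_char M (int k * (int x - int y)) * complex_of_real (sqrt (P k) - sqrt (1 / real M)))
      \<le> of_nat (card {..<M}) * (sqrt M * R)"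
    by (rule order_trans[OF norm_sum sum_bounded_above])
      (use sq in \<open>simp add: norm_mult del: of_real_diff\<close>)
  then have "cmod (inner_cv d (Phi y) (v x)) \<le> 1 / sqrt M * (of_nat (card {..<M}) * (sqrt M * R))"
    unfolding inner by (intro mult_left_mono) auto
  also have "\<dots> = real M * R" using M_pos by simp
  finally have "(cmod (inner_cv d (Phi y) (v x)))\<^sup>2 \<le> (real M * R)\<^sup>2"
    by (intro power_mono) auto
  moreover have "outcome fourier_povm x y = 1 / real M * (cmod (inner_cv d (Phi y) (v x)))\<^sup>2"
    using True unfolding outcome_def by (subst sesq_rank_one[of _ _ "Phi y"]) (auto simp: fourier_povm_def)
  ultimately have "outcome fourier_povm x y \<le> 1 / real M * (real M * R)\<^sup>2"
    by (auto intro!: divide_right_mono)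
  also have "\<dots> = real M * R\<^sup>2" using M_pos by (simp add: power2_eq_square)
  finally show ?thesis .
next
  case False
  \<comment> \<open>The unit vector \<open>v x\<close> lies in the span of the \<open>W k\<close>,
    so the complementary outcome never occurs.\<close>
  have "(\<Sum>k<M. complex_of_real ((cmod (inner_cv d (W k) (v x)))\<^sup>2)) = complex_of_real (\<Sum>k<M. P k)"
    unfolding of_real_sum using x P_nonneg by (intro sum.cong refl) (simp add: inner_W_v norm_mult)
  then have "outcome fourier_povm x y = 0"
    using x by (simp add: outcome_def sesq_complement[OF False] gram s_0 sum_P)
  then show ?thesis by simp
qed

lemma mutual_info_fourier_ge:
  assumes "B \<ge> 0" "R > 0 \<Longrightarrow> - ln (real M * R\<^sup>2) \<le> B"
  shows "mutual_info M (Suc M) (outcome fourier_povm)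
    \<ge> log 2 M - real (Suc M) * real M * (real M * R\<^sup>2) * (real M + 1 + B) / ln 2"
proof (rule mutual_info_ge_of_small_error)
  show "real M * R\<^sup>2 \<ge> 0" by simp
  show "- ln (real M * R\<^sup>2) \<le> B" if "real M * R\<^sup>2 > 0"
    using that R_nonneg by (intro assms(2)) (cases "R = 0", auto)
qed (use M_pos outcome_nonneg[OF povm_fourier] sum_outcome[OF povm_fourier] fourier_outcome_error assms(1) in auto)

lemma Sup_mutual_info_bounds:
  assumes "B \<ge> 0" "R > 0 \<Longrightarrow> - ln (real M * R\<^sup>2) \<le> B"
  defines "I \<equiv> Sup {mutual_info M n (outcome E) | n E. povm d n E}"
  shows "2 * R\<^sup>2 / ((real M)\<^sup>2 * ln 2) \<le> log 2 M - I"
    and "log 2 M - I \<le> real (Suc M) * real M * (real M * R\<^sup>2) * (real M + 1 + B) / ln 2"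
proof -
  let ?S = "{mutual_info M n (outcome E) | n E. povm d n E}"
  let ?u = "log 2 M - 2 * R\<^sup>2 / ((real M)\<^sup>2 * ln 2)"
  have upper: "z \<le> ?u" if "z \<in> ?S" for z using that mutual_info_outcome_le by auto
  have fourier: "mutual_info M (Suc M) (outcome fourier_povm) \<in> ?S" using povm_fourier by blast
  have "I \<le> ?u" unfolding I_def using fourier upper by (intro cSup_least) auto
  then show "2 * R\<^sup>2 / ((real M)\<^sup>2 * ln 2) \<le> log 2 M - I" by simp
  have "mutual_info M (Suc M) (outcome fourier_povm) \<le> I"
    unfolding I_def using fourier upper by (intro cSup_upper bdd_aboveI[of _ ?u]) auto
  then show "log 2 M - I \<le> real (Suc M) * real M * (real M * R\<^sup>2) * (real M + 1 + B) / ln 2"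
    using mutual_info_fourier_ge[OF assms(1,2)] by simp
qed

end

section \<open>Rates\<close>

text \<open>After taking logarithms and dividing by \<open>N\<close>, constants and the factor
  \<open>N\<close> contribute terms tending to zero; only \<open>- 2 * log 2 r\<close>
  survives.\<close>

lemma lin_rate:
  assumes r: "0 \<le> r" "r \<le> 1" and c: "c > 0"
    and lower: "\<And>N. N \<ge> 1 \<Longrightarrow> c * r ^ (2 * N) \<le> log 2 (real M) - f N"
    and upper: "\<And>N. N \<ge> 1 \<Longrightarrow> log 2 (real M) - f N \<le> C * real N * r ^ (2 * N)"
  shows "((\<lambda>N. lin M (f N) / ereal (real N)) \<longlongrightarrow> neg2log r) sequentially"
proof (cases "r = 0")
  case True
  \<comment> \<open>For \<open>r = 0\<close> the upper bound forces \<open>f N \<ge> log M\<close>,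
    where \<open>lin\<close> takes the value infinity, in agreement with
    \<open>neg2log 0\<close>.\<close>
  have "lin M (f N) / ereal (real N) = \<infinity>" if "N \<ge> 1" for N
    using upper[OF that] that True by (simp add: power_0_left lin_def divide_ereal_def)
  then have "\<forall>\<^sub>F N in sequentially. lin M (f N) / ereal (real N) = \<infinity>"
    by (rule eventually_mono[OF eventually_ge_at_top[of "1::nat"]])
  then show ?thesis using True by (simp add: neg2log_def tendsto_eventually)
next
  case False
  with r have r: "r > 0" by simp
  define D where "D N = log 2 (real M) - f N" for N
  have pos: "D N > 0" if "N \<ge> 1" for N
    using less_le_trans[OF mult_pos_pos[OF c zero_less_power[OF r]] lower[OF that]] by (simp add: D_def)
  have C: "C > 0"
    using less_le_trans[OF pos[of 1], OF _ upper[of 1, folded D_def]] r by (simp add: zero_less_mult_iff)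
  have lim0: "((\<lambda>N. a / real N) \<longlongrightarrow> 0) sequentially" for a
    by (rule real_tendsto_divide_at_top[OF tendsto_const filterlim_real_sequentially])
  have limln: "((\<lambda>N. ln (real N) / real N) \<longlongrightarrow> 0) sequentially"
    by (rule filterlim_compose[OF ln_x_over_x_tendsto_0 filterlim_real_sequentially])
  have "((\<lambda>N. - log 2 (D N) / real N) \<longlongrightarrow> - 2 * log 2 r) sequentially"
  proof (rule tendsto_sandwich)
    show "((\<lambda>N. - log 2 C / real N - ln (real N) / real N / ln 2 - 2 * log 2 r) \<longlongrightarrow> - 2 * log 2 r) sequentially"
      using tendsto_diff[OF tendsto_diff[OF lim0[of "- log 2 C"] tendsto_divide[OF limln tendsto_const[of "ln 2"]]] tendsto_const[of "2 * log 2 r"]]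
      by simp
    show "((\<lambda>N. - log 2 c / real N - 2 * log 2 r) \<longlongrightarrow> - 2 * log 2 r) sequentially"
      using tendsto_diff[OF lim0[of "- log 2 c"] tendsto_const[of "2 * log 2 r"]] by simp
    show "\<forall>\<^sub>F N in sequentially. - log 2 C / real N - ln (real N) / real N / ln 2 - 2 * log 2 r \<le> - log 2 (D N) / real N"
      using eventually_ge_at_top[of "1::nat"]
    proof eventually_elim
      case (elim N)
      have "log 2 (D N) \<le> log 2 (C * real N * r ^ (2 * N))"
        using upper[OF elim] pos[OF elim] elim C r by (simp add: D_def)
      also have "\<dots> = log 2 C + ln (real N) / ln 2 + 2 * real N * log 2 r"
        using elim C r by (simp add: log_mult log_nat_power) (simp add: log_def)
      finally have "- (log 2 C + ln (real N) / ln 2 + 2 * real N * log 2 r) / real N \<le> - log 2 (D N) / real N"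
        by (intro divide_right_mono) auto
      then show ?case using elim by (simp add: diff_divide_distrib add_divide_distrib mult.commute)
    qed
    show "\<forall>\<^sub>F N in sequentially. - log 2 (D N) / real N \<le> - log 2 c / real N - 2 * log 2 r"
      using eventually_ge_at_top[of "1::nat"]
    proof eventually_elim
      case (elim N)
      have "log 2 c + 2 * real N * log 2 r = log 2 (c * r ^ (2 * N))"
        using elim c r by (simp add: log_mult log_nat_power)
      also have "\<dots> \<le> log 2 (D N)"
        using lower[OF elim] pos[OF elim] c r by (simp add: D_def)
      finally have "- log 2 (D N) / real N \<le> - (log 2 c + 2 * real N * log 2 r) / real N"
        by (intro divide_right_mono) auto
      then show ?case using elim by (simp add: diff_divide_distrib add_divide_distrib)
    qed
  qed
  then have "((\<lambda>N. ereal (- log 2 (D N) / real N)) \<longlongrightarrow> neg2log r) sequentially"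
    using r by (simp add: neg2log_def)
  moreover have "\<forall>\<^sub>F N in sequentially. ereal (- log 2 (D N) / real N) = lin M (f N) / ereal (real N)"
    using eventually_ge_at_top[of "1::nat"]
    by eventually_elim (use pos in \<open>auto simp: lin_def D_def\<close>)
  ultimately show ?thesis by (rule Lim_transform_eventually)
qed

section \<open>The concrete orbit of tensor powers\<close>

lemma root_char_eq_exp:
  "exp (2 * pi * \<i> * of_nat (n * m) / of_nat M) = root_char M (int m * int n)"
  by (simp add: root_char_def cis_conv_exp mult_ac)

lemma root_char_mod: "M > 0 \<Longrightarrow> root_char M (a * (z mod int M)) = root_char M (a * z)"
proof -
  assume M: "M > 0"
  have "a * z = a * (z mod int M) + int M * (a * (z div int M))"
    by (metis mult.left_commute distrib_left add.commute mult_div_mod_eq)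
  then show ?thesis
    using root_char_eq_1_iff[OF M, of "int M * (a * (z div int M))"] by (simp add: root_char_add)
qed

text \<open>The characteristic function of \<open>p\<close>; its value at \<open>b - a\<close> is
  the overlap of the single-copy states shifted by \<open>a\<close> and by \<open>b\<close>.\<close>

definition char_fn :: "nat \<Rightarrow> (nat \<Rightarrow> real) \<Rightarrow> int \<Rightarrow> complex" where
  "char_fn M p z = (\<Sum>m<M. root_char M (int m * z) * complex_of_real (p m))"

definition orbit_vec :: "nat \<Rightarrow> (nat \<Rightarrow> real) \<Rightarrow> nat \<Rightarrow> nat \<Rightarrow> nat \<Rightarrow> complex" where
  "orbit_vec M p N x i = kpow (Tgen M x * ket M p) N $$ (i, 0)"

lemma Tgen_carrier [simp]: "Tgen M g \<in> carrier_mat M M" and ket_carrier [simp]: "ket M p \<in> carrier_mat M 1"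
  by (simp_all add: Tgen_def ket_def)

lemma dim_Tgen [simp]: "dim_row (Tgen M g) = M" "dim_col (Tgen M g) = M"
  and dim_ket [simp]: "dim_row (ket M p) = M" "dim_col (ket M p) = 1"
  by (simp_all add: Tgen_def ket_def)

lemma kpow_carrier_col: "A \<in> carrier_mat m 1 \<Longrightarrow> kpow A N \<in> carrier_mat (m ^ N) 1"
  by (intro carrier_matI) auto

lemma Tgen_ket_index:
  assumes "i < M"
  shows "(Tgen M x * ket M p) $$ (i, 0) = root_char M (int i * int x) * complex_of_real (sqrt (p i))"
proof -
  let ?E = "exp (2 * pi * \<i> * of_nat (i * x) / of_nat M)"
  have "(Tgen M x * ket M p) $$ (i, 0) = (\<Sum>j<M. (if i = j then ?E else 0) * complex_of_real (sqrt (p j)))"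
    using assms by (simp add: Tgen_def ket_def scalar_prod_def lessThan_atLeast0)
  also have "\<dots> = (\<Sum>j<M. if i = j then ?E * complex_of_real (sqrt (p j)) else 0)"
    by (intro sum.cong) auto
  finally show ?thesis using assms unfolding root_char_eq_exp by (simp add: mult.commute)
qed

text \<open>The product of an adjoint power with a power is the Kronecker power of a 1 by 1 matrix,
  hence an ordinary power of a scalar.\<close>

lemma kpow_gram:
  assumes "u \<in> carrier_mat m 1" "w \<in> carrier_mat m 1"
  shows "inner_cv (m ^ N) (\<lambda>i. kpow u N $$ (i, 0)) (\<lambda>i. kpow w N $$ (i, 0))
    = (\<Sum>i<m. cnj (u $$ (i, 0)) * w $$ (i, 0)) ^ N"
proof -
  have dims: "dim_row u = m" "dim_col u = 1" "dim_row w = m" "dim_col w = 1" using assms by auto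
  have "inner_cv (m ^ N) (\<lambda>i. kpow u N $$ (i, 0)) (\<lambda>i. kpow w N $$ (i, 0))
      = (mat_adjoint (kpow u N) * kpow w N) $$ (0, 0)"
    using dims by (simp add: inner_cv_def scalar_prod_def lessThan_atLeast0)
  also have "mat_adjoint (kpow u N) * kpow w N = kpow (mat_adjoint u * w) N"
    using dims by (simp add: mat_adjoint_kpow kpow_mult)
  also have "\<dots> $$ (0, 0) = ((mat_adjoint u * w) $$ (0, 0)) ^ N"
    using dims by (intro kpow_scalar carrier_matI) auto
  also have "(mat_adjoint u * w) $$ (0, 0) = (\<Sum>i<m. cnj (u $$ (i, 0)) * w $$ (i, 0))"
    using dims by (simp add: scalar_prod_def lessThan_atLeast0)
  finally show ?thesis .
qed

locale cyclic_state =
  fixes M :: nat and p :: "nat \<Rightarrow> real"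
  assumes M: "M \<ge> 2" and p_nonneg: "\<And>k. k < M \<Longrightarrow> p k \<ge> 0" and sum_p: "(\<Sum>k<M. p k) = 1"
begin

definition r_max :: real where
  "r_max = Max ((\<lambda>n. cmod (char_fn M p (int n))) ` {1..M-1})"

lemma char_fn_le_r_max: "n \<in> {1..<M} \<Longrightarrow> cmod (char_fn M p (int n)) \<le> r_max"
  unfolding r_max_def by (intro Max_ge) auto

lemma r_max_attained: "\<exists>n\<in>{1..<M}. cmod (char_fn M p (int n)) = r_max"
proof -
  have "r_max \<in> (\<lambda>n. cmod (char_fn M p (int n))) ` {1..M-1}"
    unfolding r_max_def using M by (intro Max_in) auto
  then show ?thesis using M by force
qed

lemma r_max_nonneg: "r_max \<ge> 0"
  using r_max_attained norm_ge_zero by metis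

lemma r_max_le_1: "r_max \<le> 1"
proof -
  have "cmod (char_fn M p z) \<le> (\<Sum>k<M. p k)" for z
    unfolding char_fn_def by (rule sum_norm_le) (simp add: norm_mult p_nonneg)
  then show ?thesis using r_max_attained sum_p by metis
qed

lemma gram_orbit_vec:
  "inner_cv (M ^ N) (orbit_vec M p N a) (orbit_vec M p N b) = char_fn M p (int b - int a) ^ N"
proof -
  have "cnj (root_char M (int m * int a) * complex_of_real (sqrt (p m))) *
      (root_char M (int m * int b) * complex_of_real (sqrt (p m)))
      = root_char M (int m * (int b - int a)) * complex_of_real (p m)" if "m < M" for m
  proof -
    have "root_char M (int m * (int b - int a)) = root_char M (- (int m * int a)) * root_char M (int m * int b)"
      by (simp add: root_char_add[symmetric] right_diff_distrib)
    moreover have "complex_of_real (p m) = complex_of_real (sqrt (p m)) * complex_of_real (sqrt (p m))"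
      unfolding of_real_mult[symmetric] using p_nonneg[OF that] by simp
    ultimately show ?thesis by (simp add: mult_ac del: of_real_mult)
  qed
  then show ?thesis
    unfolding orbit_vec_def char_fn_def
    by (subst kpow_gram) (auto simp: Tgen_ket_index simp del: index_mult_mat intro!: mult_carrier_mat[of _ M M] arg_cong[where f = "\<lambda>z. z ^ N"] sum.cong)
qed

text \<open>Overlaps of \<open>N\<close> copies are \<open>N\<close>-th powers of single-copy
  overlaps, and powers preserve the order of moduli, so the maximum becomes
  \<open>r_max ^ N\<close>.\<close>

sublocale orbit: cyclic_orbit M "M ^ N" "orbit_vec M p N" "\<lambda>z. char_fn M p z ^ N" "r_max ^ N" for N
proof
  show "\<exists>n\<in>{1..<M}. cmod (char_fn M p (int n) ^ N) = r_max ^ N"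
    using r_max_attained by (metis norm_power)
  show "cmod (char_fn M p (int n) ^ N) \<le> r_max ^ N" if "n \<in> {1..<M}" for n
    using char_fn_le_r_max[OF that] by (simp add: norm_power power_mono)
  show "char_fn M p 0 ^ N = 1"
    using arg_cong[OF sum_p, of complex_of_real] by (simp add: char_fn_def)
  show "char_fn M p (z mod int M) ^ N = char_fn M p z ^ N" for z
    using M by (simp add: char_fn_def root_char_mod)
qed (use M in \<open>auto simp: gram_orbit_vec\<close>)

lemma acc_info_eq_Sup:
  "acc_info M p N = Sup {mutual_info M n (orbit.outcome N E) | n E. povm (M ^ N) n E}"
proof -
  have "mutual_info M n (\<lambda>x y. (1 / real M) * Re (mtrace (E y * proj (kpow (Tgen M x * ket M p) N))))
      = mutual_info M n (orbit.outcome N E)" if "povm (M ^ N) n E" for n E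
  proof (rule mutual_info_cong)
    fix x y assume "y < n"
    then have "E y \<in> carrier_mat (M ^ N) (M ^ N)" using that by (simp add: povm_def psd_iff)
    moreover have "kpow (Tgen M x * ket M p) N \<in> carrier_mat (M ^ N) 1"
      by (intro kpow_carrier_col mult_carrier_mat[of _ M M]) auto
    ultimately show "(1 / real M) * Re (mtrace (E y * proj (kpow (Tgen M x * ket M p) N))) = orbit.outcome N E x y"
      unfolding orbit.outcome_def by (simp add: mtrace_mult_proj orbit_vec_def[abs_def])
  qed
  then have "{mutual_info M n (\<lambda>x y. (1 / real M) * Re (mtrace (E y * proj (kpow (Tgen M x * ket M p) N)))) | n E. povm (M ^ N) n E}
      = {mutual_info M n (orbit.outcome N E) | n E. povm (M ^ N) n E}"
    by (intro Collect_cong) metis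
  then show ?thesis unfolding acc_info_def by simp
qed

text \<open>The projector has the form \<open>A * mat_adjoint A\<close> with one unit column; its
  Gram matrix is the scalar 1, and \<open>eta 1 = 0\<close>.\<close>

lemma vN_entropy_pure: "vN_entropy (kpow (proj (ket M p)) N) = 0"
proof -
  let ?V = "kpow (ket M p) N"
  have V: "?V \<in> carrier_mat (M ^ N) 1" by (rule kpow_carrier_col[OF ket_carrier])
  have "mat_adjoint ?V * ?V = kpow (mat_adjoint (ket M p) * ket M p) N"
    by (simp add: mat_adjoint_kpow kpow_mult)
  moreover have "(mat_adjoint (ket M p) * ket M p) $$ (0, 0) = 1"
  proof -
    have "(mat_adjoint (ket M p) * ket M p) $$ (0, 0) = (\<Sum>i<M. complex_of_real (sqrt (p i)) * complex_of_real (sqrt (p i)))"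
      by (simp add: scalar_prod_def lessThan_atLeast0 ket_def del: of_real_mult)
    also have "\<dots> = (\<Sum>i<M. complex_of_real (p i))"
      unfolding of_real_mult[symmetric] using p_nonneg by (intro sum.cong) auto
    also have "\<dots> = 1" using arg_cong[OF sum_p, of complex_of_real] by simp
    finally show ?thesis .
  qed
  ultimately have "(mat_adjoint ?V * ?V) $$ (0, 0) = 1"
    by (simp add: kpow_scalar[OF carrier_matI])
  then have "mat_adjoint ?V * ?V = mat 1 1 (\<lambda>(i, j). if i = j then complex_of_real 1 else 0)"
    by (intro eq_matI) auto
  from vN_entropy_mult_adjoint[OF V this] show ?thesis
    unfolding kpow_proj unfolding proj_def by (simp add: eta_def)
qed

text \<open>The matrix \<open>?A\<close> has the charge components as columns: it factorizes the
  twirled state, and its Gram matrix is diagonal.\<close>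

lemma vN_entropy_twirl:
  "vN_entropy (twirl M N (kpow (proj (ket M p)) N)) = - (\<Sum>k<M. eta (orbit.P N k))"
proof -
  let ?d = "M ^ N" and ?A = "mat (M ^ N) M (\<lambda>(i, k). orbit.phi N k i)"
  have carr: "kpow (Tgen M g * ket M p) N \<in> carrier_mat ?d 1" for g
    by (intro kpow_carrier_col mult_carrier_mat[of _ M M]) auto
  have "twirl M N (kpow (proj (ket M p)) N) = ?A * mat_adjoint ?A"
  proof (rule eq_matI)
    fix i j assume "i < dim_row (?A * mat_adjoint ?A)" "j < dim_col (?A * mat_adjoint ?A)"
    then have ij: "i < ?d" "j < ?d" by auto
    have "twirl M N (kpow (proj (ket M p)) N) $$ (i, j)
        = 1 / of_nat M * (\<Sum>g<M. orbit_vec M p N g i * cnj (orbit_vec M p N g j))"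
      using ij by (simp add: twirl_def msum_def kpow_conj_proj proj_index[OF carr] orbit_vec_def)
    also have "\<dots> = (\<Sum>k<M. orbit.phi N k i * cnj (orbit.phi N k j))"
      using M by (simp add: orbit.sum_v_outer)
    also have "\<dots> = (?A * mat_adjoint ?A) $$ (i, j)"
      using ij by (simp add: scalar_prod_def lessThan_atLeast0)
    finally show "twirl M N (kpow (proj (ket M p)) N) $$ (i, j) = (?A * mat_adjoint ?A) $$ (i, j)" .
  qed (simp_all add: twirl_def msum_def)
  moreover have "mat_adjoint ?A * ?A = mat M M (\<lambda>(i, j). if i = j then complex_of_real (orbit.P N i) else 0)"
  proof (rule eq_matI)
    fix k l assume "k < dim_row (mat M M (\<lambda>(i, j). if i = j then complex_of_real (orbit.P N i) else 0))"
      "l < dim_col (mat M M (\<lambda>(i, j). if i = j then complex_of_real (orbit.P N i) else 0))"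
    then have kl: "k < M" "l < M" by auto
    then have "(mat_adjoint ?A * ?A) $$ (k, l) = inner_cv ?d (orbit.phi N k) (orbit.phi N l)"
      by (simp add: scalar_prod_def lessThan_atLeast0 inner_cv_def)
    then show "(mat_adjoint ?A * ?A) $$ (k, l)
        = mat M M (\<lambda>(i, j). if i = j then complex_of_real (orbit.P N i) else 0) $$ (k, l)"
      using kl by (simp add: orbit.inner_phi orbit.dft_eq_P)
  qed auto
  ultimately show ?thesis using vN_entropy_mult_adjoint[of ?A ?d M] by simp
qed

lemma asym_eq: "log 2 (real M) - asym M p N = log 2 M + (\<Sum>k<M. eta (orbit.P N k))"
  by (simp add: asym_def vN_entropy_twirl vN_entropy_pure)

lemma power_double: "(r_max ^ N)\<^sup>2 = r_max ^ (2 * N)"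
  by (simp add: power_mult[symmetric] mult.commute)

lemma asym_rate: "((\<lambda>N. lin M (asym M p N) / ereal (real N)) \<longlongrightarrow> neg2log r_max) sequentially"
proof (rule lin_rate[OF r_max_nonneg r_max_le_1])
  show "1 / (real M * (sqrt M + 1)\<^sup>2 * ln 2) > 0"
    using M by (intro divide_pos_pos mult_pos_pos zero_less_power) (auto intro: add_nonneg_pos)
  fix N :: nat assume N: "N \<ge> 1"
  show "1 / (real M * (sqrt M + 1)\<^sup>2 * ln 2) * r_max ^ (2 * N) \<le> log 2 (real M) - asym M p N"
    using orbit.entropy_lower[of N] by (simp add: asym_eq power_double)
  have "log 2 (real M) - asym M p N \<le> (real M)\<^sup>2 / ln 2 * r_max ^ (2 * N) * 1"
    using orbit.entropy_upper[of N] by (simp add: asym_eq power_double)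
  \<comment> \<open>This bound has no factor \<open>N\<close>; one is inserted to match the form
    shared with the accessible information.\<close>
  also have "\<dots> \<le> (real M)\<^sup>2 / ln 2 * r_max ^ (2 * N) * real N"
    using N r_max_nonneg by (intro mult_left_mono) auto
  finally show "log 2 (real M) - asym M p N \<le> (real M)\<^sup>2 / ln 2 * real N * r_max ^ (2 * N)"
    by (simp add: mult_ac)
qed

lemma acc_info_rate: "((\<lambda>N. lin M (acc_info M p N) / ereal (real N)) \<longlongrightarrow> neg2log r_max) sequentially"
proof (rule lin_rate[OF r_max_nonneg r_max_le_1])
  let ?C = "real (Suc M) * real M * real M * (real M + 1 + 2 * - ln r_max) / ln 2"
  show "2 / ((real M)\<^sup>2 * ln 2) > 0" using M by simp
  fix N :: nat assume N: "N \<ge> 1"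
  \<comment> \<open>If \<open>r_max = 0\<close>, the default value \<open>ln 0 = 0\<close> keeps
    this true.\<close>
  have ln_r: "- ln r_max \<ge> 0"
    using r_max_nonneg r_max_le_1 by (cases "r_max = 0") auto
  \<comment> \<open>The bound on \<open>- ln\<close> of the error grows linearly in
    \<open>N\<close>. This is the source of the factor \<open>N\<close> in the upper bound on the
    deficit.\<close>
  have B: "2 * real N * - ln r_max \<ge> 0" using ln_r by (intro mult_nonneg_nonneg) auto
  have ln_bound: "- ln (real M * (r_max ^ N)\<^sup>2) \<le> 2 * real N * - ln r_max" if "r_max ^ N > 0"
  proof -
    have "r_max > 0" using that N r_max_nonneg by (cases "r_max = 0") (auto simp: power_0_left)
    then have "ln (real M * (r_max ^ N)\<^sup>2) = ln (real M) + 2 * real N * ln r_max"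
      using M unfolding power_double by (simp add: ln_mult ln_realpow)
    moreover have "ln (real M) \<ge> 0" using M by simp
    ultimately show ?thesis by simp
  qed
  note bounds = orbit.Sup_mutual_info_bounds[of "2 * real N * - ln r_max" N, OF B ln_bound, folded acc_info_eq_Sup]
  show "2 / ((real M)\<^sup>2 * ln 2) * r_max ^ (2 * N) \<le> log 2 (real M) - acc_info M p N"
    using bounds(1) by (simp add: power_double)
  have "real M + 1 + 2 * real N * - ln r_max \<le> (real M + 1) * real N + 2 * real N * - ln r_max"
    using N by (intro add_right_mono) simp
  also have "\<dots> = real N * (real M + 1 + 2 * - ln r_max)" by (simp add: algebra_simps)
  finally have "real (Suc M) * real M * (real M * (r_max ^ N)\<^sup>2) * (real M + 1 + 2 * real N * - ln r_max) / ln 2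
      \<le> real (Suc M) * real M * (real M * (r_max ^ N)\<^sup>2) * (real N * (real M + 1 + 2 * - ln r_max)) / ln 2"
    by (intro divide_right_mono mult_left_mono) auto
  also have "\<dots> = ?C * real N * r_max ^ (2 * N)" unfolding power_double by simp
  finally show "log 2 (real M) - acc_info M p N \<le> ?C * real N * r_max ^ (2 * N)"
    using bounds(2) by linarith
qed

end

theorem theorem2:
  fixes M :: nat and p :: "nat \<Rightarrow> real"
  assumes "M \<ge> 2"
    and "\<forall>k<M. p k \<ge> 0"
    and "(\<Sum>k<M. p k) = 1"
  shows "let r_max = Max ((\<lambda>n. cmod (\<Sum>m<M. exp (2 * pi * \<i> * of_nat (n * m) / of_nat M) * complex_of_real (p m))) ` {1..M-1})
         in ((\<lambda>N. lin M (acc_info M p N) / ereal (real N)) \<longlongrightarrow> neg2log r_max) sequentially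
          \<and> ((\<lambda>N. lin M (asym M p N) / ereal (real N)) \<longlongrightarrow> neg2log r_max) sequentially"
proof -
  interpret cyclic_state M p by standard (use assms in auto)
  show ?thesis
    unfolding Let_def root_char_eq_exp char_fn_def[symmetric] r_max_def[symmetric]
    using acc_info_rate asym_rate by (rule conjI)
qed

end
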